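(* Let $k$ be a field, let $m\ge 3$ and $s\ge 2$ be integers, let $R=k[x_1,\dots,x_m]$, and let $r\in\{1,\dots,m\}$ with $r\ne m-s-1$. Let $G=K_m$ be the complete graph on the vertices $x_1,\dots,x_m$, and let $H=K_r$ be its induced subgraph on $x_1,\dots,x_r$. Let $I_{G\setminus H,s}=I(G)^{(s)}\cap\langle \prod_{j=r+1}^m x_j\rangle$ if $r\neq m$, and $I_{G\setminus H,s}=I(G)^{(s)}$ if $r=m$. If $$L_1=\langle w\in\mathcal G(I_{G\setminus H,s}) : x_r\mid w\rangle = I_{G\setminus H,s}\cap\langle x_r\rangle \quad\text{and}\quad L_2=\langle w\in\mathcal G(I_{G\setminus H,s}) : x_r\nmid w\rangle,$$ then $I_{G\setminus H,s}=L_1+L_2$ is an Eliahou-Kervaire splitting.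
   Context: For a finite simple graph $G$ with vertex set $\{x_1,\dots,x_m\}$ and edge set $E(G)$, the edge ideal is $I(G)=\langle x_ix_j : \{x_i,x_j\}\in E(G)\rangle\subset R$. $K_m$ denotes the complete graph on $m$ vertices. Symbolic powers: for a monomial ideal $I\subset R$ with primary decomposition $I=I_1\cap\dots\cap I_n$, and $Q$ an associated prime of $I$ that is maximal with respect to inclusion, put $I_{\subseteq Q}=\bigcap_{\sqrt{I_\ell}\subseteq Q}I_\ell$. The $s$-th symbolic power is $I^{(s)}=\bigcap_{Q}I_{\subseteq Q}^s$, the intersection running over all associated primes $Q$ of $I$ that are maximal with respect to inclusion. $\mathcal G(I)$ denotes the (unique) set of minimal monomial generators of a monomial ideal $I$. Eliahou-Kervaire splitting: let $I,J,K$ be monomial ideals of $R$ such that $\mathcal G(I)$ is the disjoint union of $\mathcal G(J)$ and $\mathcal G(K)$. Then $I=J+K$ is an Eliahou-Kervaire splitting if there is a function $\mathcal G(J\cap K)\to\mathcal G(J)\times\mathcal G(K)$, $w\mapsto(\phi(w),\varphi(w))$, such that (1) $w=\mathrm{lcm}(\phi(w),\varphi(w))$ for all $w\in\mathcal G(J\cap K)$; and (2) for every nonempty subset $S\subseteq\mathcal G(J\cap K)$, both $\mathrm{lcm}(\phi(S))$ and $\mathrm{lcm}(\varphi(S))$ strictly divide $\mathrm{lcm}(S)$ (i.e. divide it and are not equal to it).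
   Formalization: The equality of L_1 with I_{G∖H,s} ∩ ⟨x_r⟩ is asserted only for r ≥ m−s, since it fails for r < m−s−1 (there L_1 = 0, e.g. m=5, s=2, r=1); L_1 is defined by the generators divisible by x_r, and the splitting is proved for all allowed r. *)

theory Defs
  imports "HOL-Algebra.Ideal_Product" "HOL-Library.Poly_Mapping" "HOL-Library.Multiset"
begin

section \<open>Polynomial rings and monomials\<close>

text \<open>
  A monomial is the finite multiset of its variables: products are sums of multisets,
  divisibility is \<open>\<subseteq>#\<close>, and the least common multiple of a set of monomials is \<open>Sup\<close>.
  The functions \<^typ>\<open>'v multiset \<Rightarrow>\<^sub>0 'k\<close> with convolution product are the polynomials in the
  variables of type \<^typ>\<open>'v\<close>; \<open>poly_ring V\<close> is the subring \<open>k[x\<^sub>v : v \<in> V]\<close>.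
\<close>

type_synonym ('v, 'k) mpoly = "'v multiset \<Rightarrow>\<^sub>0 'k"

definition poly_ring :: "'v set \<Rightarrow> ('v, 'k :: field) mpoly ring" where
  "poly_ring V = \<lparr> carrier = {p. \<forall>t \<in> Poly_Mapping.keys p. set_mset t \<subseteq> V},
                   monoid.mult = (*), one = 1, zero = 0, add = (+) \<rparr>"

definition monomial :: "'v multiset \<Rightarrow> ('v, 'k :: field) mpoly" where
  "monomial t = Poly_Mapping.single t 1"

definition indet :: "'v \<Rightarrow> ('v, 'k :: field) mpoly" where
  "indet v = monomial {#v#}"

definition monomial_ideal :: "('v, 'k :: field) mpoly ring \<Rightarrow> ('v, 'k) mpoly set \<Rightarrow> bool" where
  "monomial_ideal R I \<longleftrightarrow> (\<exists>A. monomial ` A \<subseteq> carrier R \<and> I = Idl\<^bsub>R\<^esub> (monomial ` A))"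

definition is_min_gens ::
    "('v, 'k :: field) mpoly ring \<Rightarrow> ('v, 'k) mpoly set \<Rightarrow> 'v multiset set \<Rightarrow> bool" where
  "is_min_gens R I A \<longleftrightarrow> monomial ` A \<subseteq> carrier R \<and> I = Idl\<^bsub>R\<^esub> (monomial ` A) \<and>
     (\<forall>B. B \<subset> A \<longrightarrow> I \<noteq> Idl\<^bsub>R\<^esub> (monomial ` B))"

definition min_gens ::
    "('v, 'k :: field) mpoly ring \<Rightarrow> ('v, 'k) mpoly set \<Rightarrow> 'v multiset set" where
  "min_gens R I = (THE A. is_min_gens R I A)"


section \<open>Symbolic powers\<close>

definition radical :: "'a ring \<Rightarrow> 'a set \<Rightarrow> 'a set" where
  "radical R I = {a \<in> carrier R. \<exists>n :: nat. a [^]\<^bsub>R\<^esub> n \<in> I}"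

definition primary_ideal :: "'a ring \<Rightarrow> 'a set \<Rightarrow> bool" where
  "primary_ideal R I \<longleftrightarrow> ideal I R \<and> I \<noteq> carrier R \<and>
     (\<forall>a \<in> carrier R. \<forall>b \<in> carrier R. a \<otimes>\<^bsub>R\<^esub> b \<in> I \<longrightarrow> a \<in> I \<or> b \<in> radical R I)"

text \<open>In the following definitions \<open>carrier R\<close> makes the empty intersection the unit ideal.\<close>

definition primary_decomposition :: "'a ring \<Rightarrow> 'a set \<Rightarrow> 'a set set \<Rightarrow> bool" where
  "primary_decomposition R I D \<longleftrightarrow>
     finite D \<and> (\<forall>J \<in> D. primary_ideal R J) \<and> I = carrier R \<inter> \<Inter>D"

definition associated_primes :: "'a ring \<Rightarrow> 'a set \<Rightarrow> 'a set set" where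
  "associated_primes R I =
     {Q. primeideal Q R \<and> (\<exists>f \<in> carrier R. Q = {g \<in> carrier R. g \<otimes>\<^bsub>R\<^esub> f \<in> I})}"

definition max_associated_primes :: "'a ring \<Rightarrow> 'a set \<Rightarrow> 'a set set" where
  "max_associated_primes R I =
     {Q \<in> associated_primes R I. \<forall>Q' \<in> associated_primes R I. Q \<subseteq> Q' \<longrightarrow> Q' = Q}"

text \<open>
  The ideal \<open>I\<^bsub>\<subseteq>Q\<^esub>\<close>. It is the contraction to \<open>R\<close> of the localization of \<open>I\<close> at the prime
  ideal \<open>Q\<close>, so it does not depend on the chosen primary decomposition.
\<close>

definition component_below :: "'a ring \<Rightarrow> 'a set \<Rightarrow> 'a set \<Rightarrow> 'a set" where
  "component_below R I Q =
     carrier R \<inter> \<Inter>{J \<in> (SOME D. primary_decomposition R I D). radical R J \<subseteq> Q}"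

definition symbolic_power :: "'a ring \<Rightarrow> 'a set \<Rightarrow> nat \<Rightarrow> 'a set" where
  "symbolic_power R I s =
     carrier R \<inter> (\<Inter>Q \<in> max_associated_primes R I. component_below R I Q [^]\<^bsub>ideals_set R\<^esub> s)"


section \<open>Graphs and edge ideals\<close>

text \<open>Finite simple graphs are pairs of a vertex set and a set of two-element sets of vertices.\<close>

type_synonym 'v graph = "'v set \<times> 'v set set"

abbreviation verts :: "'v graph \<Rightarrow> 'v set" where
  "verts G \<equiv> fst G"

abbreviation edges :: "'v graph \<Rightarrow> 'v set set" where
  "edges G \<equiv> snd G"

definition complete_graph :: "'v set \<Rightarrow> 'v graph" where
  "complete_graph V = (V, {e. e \<subseteq> V \<and> card e = 2})"

definition induced_subgraph :: "'v graph \<Rightarrow> 'v set \<Rightarrow> 'v graph" where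
  "induced_subgraph G W = (W, {e \<in> edges G. e \<subseteq> W})"

lemma induced_subgraph_complete_graph:
  "W \<subseteq> V \<Longrightarrow> induced_subgraph (complete_graph V) W = complete_graph W"
  by (auto simp: induced_subgraph_def complete_graph_def)

definition edge_ideal :: "('v, 'k :: field) mpoly ring \<Rightarrow> 'v graph \<Rightarrow> ('v, 'k) mpoly set" where
  "edge_ideal R G = Idl\<^bsub>R\<^esub> {indet u * indet v | u v. {u, v} \<in> edges G}"

text \<open>The ideal \<open>I\<^bsub>G\<setminus>H,s\<^esub>\<close>.\<close>

definition diff_symbolic_power ::
    "('v, 'k :: field) mpoly ring \<Rightarrow> 'v graph \<Rightarrow> 'v graph \<Rightarrow> nat \<Rightarrow> ('v, 'k) mpoly set" where
  "diff_symbolic_power R G H s =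
     (if verts H = verts G then symbolic_power R (edge_ideal R G) s
      else symbolic_power R (edge_ideal R G) s \<inter> Idl\<^bsub>R\<^esub> {\<Prod>v \<in> verts G - verts H. indet v})"


section \<open>Eliahou--Kervaire splittings\<close>

text \<open>
  The two components of the splitting function are given separately. For \<open>S\<close> a set of
  minimal generators, \<open>Sup S\<close> is a genuine least common multiple, as \<open>S\<close> is finite.
\<close>

definition EK_splitting ::
    "('v, 'k :: field) mpoly ring \<Rightarrow> ('v, 'k) mpoly set \<Rightarrow> ('v, 'k) mpoly set \<Rightarrow>
     ('v, 'k) mpoly set \<Rightarrow> bool" where
  "EK_splitting R I J K \<longleftrightarrow>
     monomial_ideal R I \<and> monomial_ideal R J \<and> monomial_ideal R K \<and>
     I = J <+>\<^bsub>R\<^esub> K \<and>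
     min_gens R I = min_gens R J \<union> min_gens R K \<and>
     min_gens R J \<inter> min_gens R K = {} \<and>
     (\<exists>\<phi> \<psi>. \<phi> \<in> min_gens R (J \<inter> K) \<rightarrow> min_gens R J \<and>
            \<psi> \<in> min_gens R (J \<inter> K) \<rightarrow> min_gens R K \<and>
            (\<forall>w \<in> min_gens R (J \<inter> K). w = \<phi> w \<union># \<psi> w) \<and>
            (\<forall>S. S \<noteq> {} \<and> S \<subseteq> min_gens R (J \<inter> K) \<longrightarrow>
                 Sup (\<phi> ` S) \<subset># Sup S \<and> Sup (\<psi> ` S) \<subset># Sup S))"

end

theory Submission
  imports Defs
begin

text \<open>
  A monomial ideal is determined by the set of its monomials, its minimal generators are the
  minimal monomials with respect to divisibility, and sums, intersections and products of monomial
  ideals can be read off from these sets. This turns the claim into one about exponents, once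
  the monomials of \<open>I(K\<^sub>m)\<^bsup>(s)\<^esup>\<close> are known. The associated primes of \<open>I(K\<^sub>m)\<close> are the ideals
  generated by all variables but one (\<open>associated_primes_edge_ideal\<close>), they are all maximal, and
  localizing at one of them gives that prime back. So \<open>I(K\<^sub>m)\<^bsup>(s)\<^esup>\<close> is the intersection of the \<open>s\<close>-th
  powers of these primes (\<open>symbolic_power_edge_ideal\<close>): it consists of the monomials \<open>t\<close> with
  \<open>deg t - deg\<^sub>i t \<ge> s\<close> for every \<open>i\<close>. The ideal \<open>I\<^bsub>G\<setminus>H,s\<^esub>\<close> adds the condition that \<open>t\<close> is divisible by
  the product \<open>F\<close> of the vertices outside \<open>H\<close>.

  The splitting rests on one exchange. Let \<open>v\<close> be a minimal generator without \<open>x\<^sub>r\<close> and let \<open>x\<^sub>c\<close>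
  divide \<open>v / F\<close>. Then \<open>x\<^sub>r v / x\<^sub>c\<close> is again in the ideal, because its degree is that of \<open>v\<close> and its
  exponents are no greater, apart from the exponent \<open>1\<close> of \<open>x\<^sub>r\<close>. A minimal generator below it
  must contain \<open>x\<^sub>r\<close>, as otherwise it would properly divide \<open>v\<close> (\<open>minimal_exchange\<close>).

  If \<open>m \<le> r + s\<close>, then \<open>F\<close> has degree at most \<open>s\<close>, while all monomials of the ideal have
  degree greater than \<open>s\<close>; so such an \<open>x\<^sub>c\<close> always exists. It follows that \<open>L\<^sub>1 = I \<inter> \<langle>x\<^sub>r\<rangle>\<close> and that the
  minimal generators of \<open>L\<^sub>1 \<inter> L\<^sub>2\<close> are of the form \<open>x\<^sub>r v\<close> with \<open>v\<close> a minimal generator of \<open>L\<^sub>2\<close>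
  (\<open>minimal_common_multiple\<close>). Send \<open>x\<^sub>r v\<close> to \<open>v\<close> and to a generator of \<open>L\<^sub>1\<close> that divides \<open>x\<^sub>r v / x\<^sub>c\<close>,
  with \<open>x\<^sub>c\<close> chosen least. The variable \<open>x\<^sub>r\<close> shows strictness for the first of these two maps. For
  the second one, strictness on a set \<open>S\<close> is visible at the least variable of \<open>lcm(S) / (x\<^sub>r F)\<close>: an
  element of \<open>S\<close> that attains the maximal exponent there has its exponent lowered there
  (\<open>Sup_lowered_strict\<close>).

  If \<open>m > r + s\<close>, then \<open>F\<close> lies in the ideal and is its only minimal generator. In that case \<open>L\<^sub>1 = 0\<close>,
  and the splitting function has empty domain.
\<close>

section \<open>Monomial ideals\<close>

definition monomial_span :: "'v multiset set \<Rightarrow> ('v, 'k :: field) mpoly set" where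
  "monomial_span U = {p. Poly_Mapping.keys p \<subseteq> U}"

text \<open>
  These are exactly the sets of monomials contained in some monomial ideal of \<open>k[x\<^sub>v : v \<in> V]\<close>.
\<close>

definition monomial_upset :: "'v set \<Rightarrow> 'v multiset set \<Rightarrow> bool" where
  "monomial_upset V U \<longleftrightarrow> (\<forall>t \<in> U. set_mset t \<subseteq> V) \<and>
     (\<forall>t \<in> U. \<forall>u. t \<subseteq># u \<longrightarrow> set_mset u \<subseteq> V \<longrightarrow> u \<in> U)"

lemma monomial_upsetD:
  "monomial_upset V U \<Longrightarrow> t \<in> U \<Longrightarrow> t \<subseteq># u \<Longrightarrow> set_mset u \<subseteq> V \<Longrightarrow> u \<in> U"
  unfolding monomial_upset_def by blast

definition multiples :: "'v set \<Rightarrow> 'v multiset set \<Rightarrow> 'v multiset set" where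
  "multiples V A = {t. set_mset t \<subseteq> V \<and> (\<exists>a \<in> A. a \<subseteq># t)}"

definition minimal_monomials :: "'v multiset set \<Rightarrow> 'v multiset set" where
  "minimal_monomials U = {t \<in> U. \<forall>u \<in> U. u \<subseteq># t \<longrightarrow> u = t}"

lemma carrier_poly_ring: "carrier (poly_ring V) = monomial_span {t. set_mset t \<subseteq> V}"
  by (auto simp: poly_ring_def monomial_span_def)

lemma poly_ring_ops [simp]:
  "x \<otimes>\<^bsub>poly_ring V\<^esub> y = x * y" "x \<oplus>\<^bsub>poly_ring V\<^esub> y = x + y"
  "\<one>\<^bsub>poly_ring V\<^esub> = 1" "\<zero>\<^bsub>poly_ring V\<^esub> = 0"
  by (simp_all add: poly_ring_def)

lemma keys_monomial [simp]:
  "Poly_Mapping.keys (monomial t :: ('v, 'k :: field) mpoly) = {t}"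
  by (simp add: monomial_def)

lemma monomial_in_span [simp]: "(monomial t :: ('v, 'k :: field) mpoly) \<in> monomial_span U \<longleftrightarrow> t \<in> U"
  by (simp add: monomial_span_def)

lemma monomial_mult: "monomial t * monomial u = (monomial (t + u) :: ('v, 'k :: field) mpoly)"
  by (simp add: monomial_def mult_single)

lemma monomial_span_mono: "U \<subseteq> U' \<Longrightarrow> monomial_span U \<subseteq> monomial_span U'"
  by (auto simp: monomial_span_def)

lemma monomial_span_subset_iff:
  "(monomial_span U :: ('v, 'k :: field) mpoly set) \<subseteq> monomial_span U' \<longleftrightarrow> U \<subseteq> U'"
  by (metis monomial_in_span monomial_span_mono subset_eq)

lemma monomial_span_eq_iff:
  "(monomial_span U :: ('v, 'k :: field) mpoly set) = monomial_span U' \<longleftrightarrow> U = U'"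
  by (simp add: set_eq_subset monomial_span_subset_iff)

lemma monomial_span_Int: "monomial_span U \<inter> monomial_span U' = monomial_span (U \<inter> U')"
  by (auto simp: monomial_span_def)

lemma monomial_span_add:
  "p \<in> monomial_span U \<Longrightarrow> q \<in> monomial_span U \<Longrightarrow> p + q \<in> monomial_span U"
  using keys_add[of p q] by (auto simp: monomial_span_def)

lemma monomial_span_mult:
  assumes "p \<in> monomial_span U" "q \<in> monomial_span U'" "\<And>t u. t \<in> U \<Longrightarrow> u \<in> U' \<Longrightarrow> t + u \<in> W"
  shows "p * q \<in> monomial_span W"
  using assms keys_mult[of p q] by (fastforce simp: monomial_span_def)

text \<open>
  Induction over the terms of a polynomial; it reduces the inclusion of a monomial ideal in
  another additively closed set to the scalar multiples of its monomials.
\<close>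

lemma monomial_span_induct [consumes 1, case_names zero add]:
  fixes p :: "('v, 'k :: field) mpoly"
  assumes "p \<in> monomial_span U" "P 0"
    and add: "\<And>q t c. P q \<Longrightarrow> t \<in> U \<Longrightarrow> P (Poly_Mapping.single t c + q)"
  shows "P p"
  using assms(1)
proof (induction p rule: update_induct)
  case const
  show ?case by fact
next
  case (update p t c)
  have eq: "Poly_Mapping.update t c p = Poly_Mapping.single t c + p"
    using update.hyps
    by (intro poly_mapping_eqI) (auto simp: lookup_update lookup_add lookup_single when_def in_keys_iff)
  have "Poly_Mapping.keys (Poly_Mapping.update t c p) = insert t (Poly_Mapping.keys p)"
    using update.hyps by (simp add: keys_update)
  then show ?case
    using update.IH update.prems add[of p t c] by (simp add: eq monomial_span_def)
qed

lemma poly_ring_cring: "cring (poly_ring V :: ('v, 'k :: field) mpoly ring)"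
proof (rule cringI)
  let ?R = "poly_ring V :: ('v, 'k) mpoly ring"
  have cl: "p + q \<in> carrier ?R" "p * q \<in> carrier ?R" if "p \<in> carrier ?R" "q \<in> carrier ?R" for p q
    using that unfolding carrier_poly_ring
    by (blast intro: monomial_span_add, elim monomial_span_mult) auto
  show "abelian_group ?R"
  proof (rule abelian_groupI)
    fix p assume "p \<in> carrier ?R"
    then have "-p \<in> carrier ?R"
      by (auto simp: carrier_poly_ring monomial_span_def in_keys_iff)
    then show "\<exists>q \<in> carrier ?R. q \<oplus>\<^bsub>?R\<^esub> p = \<zero>\<^bsub>?R\<^esub>"
      by (intro bexI[of _ "-p"]) auto
  qed (auto simp: cl algebra_simps, auto simp: carrier_poly_ring monomial_span_def)
  show "comm_monoid ?R"
    by (rule comm_monoidI) (auto simp: cl algebra_simps, auto simp: carrier_poly_ring monomial_span_def)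
qed (auto simp: algebra_simps)

lemma monomial_span_ideal:
  assumes "monomial_upset V U"
  shows "ideal (monomial_span U :: ('v, 'k :: field) mpoly set) (poly_ring V)"
proof -
  let ?R = "poly_ring V :: ('v, 'k) mpoly ring" and ?I = "monomial_span U :: ('v, 'k) mpoly set"
  interpret cring ?R by (rule poly_ring_cring)
  have sub: "U \<subseteq> {t. set_mset t \<subseteq> V}"
    using assms by (auto simp: monomial_upset_def)
  then have car: "?I \<subseteq> carrier ?R"
    unfolding carrier_poly_ring by (rule monomial_span_mono)
  have absorb: "a * x \<in> ?I" if "a \<in> ?I" "x \<in> carrier ?R" for a x
    using that unfolding carrier_poly_ring
  proof (rule monomial_span_mult)
    fix t u assume "t \<in> U" "u \<in> {t. set_mset t \<subseteq> V}"
    then show "t + u \<in> U"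
      using assms sub by (auto simp: monomial_upset_def)
  qed
  show ?thesis
  proof (rule idealI)
    show "subgroup ?I (add_monoid ?R)"
    proof (rule add.subgroupI)
      fix a assume a: "a \<in> ?I"
      then have "a * -1 \<in> ?I"
        by (rule absorb) (auto simp: carrier_poly_ring monomial_span_def in_keys_iff lookup_one when_def)
      moreover have "\<ominus>\<^bsub>?R\<^esub> a = - a"
        using a car by (intro minus_equality) (auto simp: carrier_poly_ring monomial_span_def in_keys_iff)
      ultimately show "\<ominus>\<^bsub>?R\<^esub> a \<in> ?I" by simp
    next
      have "0 \<in> ?I" by (simp add: monomial_span_def)
      then show "?I \<noteq> {}" by blast
    qed (use car monomial_span_add in auto)
  qed (use absorb in \<open>auto simp: ring_axioms mult.commute\<close>)
qed

lemma multiples_upset: "monomial_upset V (multiples V A)"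
  unfolding monomial_upset_def multiples_def by (auto intro: subset_mset.trans)

text \<open>
  A term \<open>c t\<close> whose monomial is a multiple of some \<open>a \<in> A\<close> is \<open>c (t / a) \<cdot> a\<close>. Hence the polynomials
  all of whose monomials are multiples of elements of \<open>A\<close> lie in the ideal generated by \<open>A\<close>, and
  they form an ideal themselves.
\<close>

lemma Idl_monomials:
  fixes A :: "'v multiset set"
  assumes "\<And>a. a \<in> A \<Longrightarrow> set_mset a \<subseteq> V"
  shows "Idl\<^bsub>poly_ring V\<^esub> (monomial ` A) = (monomial_span (multiples V A) :: ('v, 'k :: field) mpoly set)"
proof
  let ?R = "poly_ring V :: ('v, 'k) mpoly ring"
  interpret cring ?R by (rule poly_ring_cring)
  have A: "monomial ` A \<subseteq> carrier ?R"
    using assms by (auto simp: carrier_poly_ring)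
  show "Idl\<^bsub>?R\<^esub> (monomial ` A) \<subseteq> monomial_span (multiples V A)"
    using assms by (intro genideal_minimal monomial_span_ideal multiples_upset) (auto simp: multiples_def)
  interpret J: ideal "Idl\<^bsub>?R\<^esub> (monomial ` A)" ?R
    by (rule genideal_ideal[OF A])
  show "monomial_span (multiples V A) \<subseteq> Idl\<^bsub>?R\<^esub> (monomial ` A)"
  proof
    fix p :: "('v, 'k) mpoly" assume "p \<in> monomial_span (multiples V A)"
    then show "p \<in> Idl\<^bsub>?R\<^esub> (monomial ` A)"
    proof (induction rule: monomial_span_induct)
      case zero
      show ?case using J.zero_closed by simp
    next
      case (add q t c)
      then obtain a where a: "a \<in> A" "a \<subseteq># t" and t: "set_mset t \<subseteq> V"
        by (auto simp: multiples_def)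
      have "Poly_Mapping.single (t - a) c \<in> carrier ?R"
        using t by (auto simp: carrier_poly_ring monomial_span_def dest: in_diffD)
      moreover have "monomial a \<in> Idl\<^bsub>?R\<^esub> (monomial ` A)"
        using a genideal_self[OF A] by blast
      ultimately have "Poly_Mapping.single (t - a) c * monomial a \<in> Idl\<^bsub>?R\<^esub> (monomial ` A)"
        using J.I_l_closed by auto
      also have "Poly_Mapping.single (t - a) c * monomial a = Poly_Mapping.single t c"
        using a by (simp add: monomial_def mult_single)
      finally show ?case
        using add.IH J.a_closed by auto
    qed
  qed
qed

lemma monomial_span_sum:
  "monomial_span U <+>\<^bsub>poly_ring V\<^esub> monomial_span U' =
     (monomial_span (U \<union> U') :: ('v, 'k :: field) mpoly set)"
proof (intro equalityI subsetI)
  fix p :: "('v, 'k) mpoly" assume "p \<in> monomial_span U <+>\<^bsub>poly_ring V\<^esub> monomial_span U'"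
  then obtain q q' where "q \<in> monomial_span U" "q' \<in> monomial_span U'" "p = q + q'"
    by (auto simp: set_add_def')
  then show "p \<in> monomial_span (U \<union> U')"
    using monomial_span_add monomial_span_mono by (metis sup_ge1 sup_ge2 subsetD)
next
  fix p :: "('v, 'k) mpoly" assume "p \<in> monomial_span (U \<union> U')"
  then have "\<exists>q \<in> monomial_span U. \<exists>q' \<in> monomial_span U'. p = q + q'"
  proof (induction rule: monomial_span_induct)
    case zero
    show ?case by (rule bexI[of _ 0])+ (auto simp: monomial_span_def)
  next
    case (add p t c)
    then obtain q q' where q: "q \<in> monomial_span U" "q' \<in> monomial_span U'" "p = q + q'"
      by blast
    from \<open>t \<in> U \<union> U'\<close> consider "t \<in> U" | "t \<in> U'" by blast
    then show ?case
    proof cases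
      case 1
      then have "Poly_Mapping.single t c + q \<in> monomial_span U"
        using q by (intro monomial_span_add) (auto simp: monomial_span_def)
      with q show ?thesis
        by (metis add.assoc)
    next
      case 2
      then have "Poly_Mapping.single t c + q' \<in> monomial_span U'"
        using q by (intro monomial_span_add) (auto simp: monomial_span_def)
      with q show ?thesis
        by (metis add.left_commute)
    qed
  qed
  then show "p \<in> monomial_span U <+>\<^bsub>poly_ring V\<^esub> monomial_span U'"
    by (auto simp: set_add_def')
qed

lemma monomial_span_ideal_prod:
  assumes "\<And>t. t \<in> U \<Longrightarrow> set_mset t \<subseteq> V"
    and "W = {t + u | t u. t \<in> U \<and> u \<in> U'}"
  shows "ideal_prod (poly_ring V) (monomial_span U) (monomial_span U') =
     (monomial_span W :: ('v, 'k :: field) mpoly set)"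
proof (intro equalityI subsetI)
  fix p :: "('v, 'k) mpoly"
  assume "p \<in> ideal_prod (poly_ring V) (monomial_span U) (monomial_span U')"
  then show "p \<in> monomial_span W"
    by (induction rule: ideal_prod.induct)
      (auto simp: assms(2) intro: monomial_span_mult monomial_span_add)
next
  fix p :: "('v, 'k) mpoly" assume "p \<in> monomial_span W"
  moreover have single: "Poly_Mapping.single t c \<in> ideal_prod (poly_ring V) (monomial_span U) (monomial_span U')"
    if "t \<in> W" for t and c :: 'k
  proof -
    from that obtain u u' where u: "u \<in> U" "u' \<in> U'" "t = u + u'"
      using assms(2) by blast
    then have "Poly_Mapping.single u c \<otimes>\<^bsub>poly_ring V\<^esub> monomial u' \<in>
        ideal_prod (poly_ring V) (monomial_span U) (monomial_span U')"
      by (intro ideal_prod.prod) (auto simp: monomial_span_def)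
    with u show ?thesis
      by (simp add: monomial_def mult_single)
  qed
  moreover have "0 \<in> ideal_prod (poly_ring V) (monomial_span U) (monomial_span U' :: ('v, 'k) mpoly set)"
    using ideal_prod.prod[of 0 "monomial_span U" 0 "monomial_span U'" "poly_ring V"]
    by (simp add: monomial_span_def)
  ultimately show "p \<in> ideal_prod (poly_ring V) (monomial_span U) (monomial_span U')"
    by (induction rule: monomial_span_induct)
      (use ideal_prod.sum in fastforce)+
qed

text \<open>
  Proper divisibility of monomials is well-founded.
\<close>

lemma minimal_monomial_below:
  assumes "t \<in> U"
  obtains u where "u \<in> minimal_monomials U" "u \<subseteq># t"
proof -
  from assms have "\<exists>u \<in> minimal_monomials U. u \<subseteq># t"
  proof (induction t rule: wf_subset_mset_rel[THEN wf_induct_rule])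
    case (1 t)
    show ?case
    proof (cases "\<exists>u \<in> U. u \<subset># t")
      case True
      then obtain u where "u \<in> U" "u \<subset># t" by blast
      with 1(1)[of u] obtain v where "v \<in> minimal_monomials U" "v \<subseteq># u"
        by auto
      with \<open>u \<subset># t\<close> show ?thesis
        by (meson subset_mset.less_imp_le subset_mset.trans)
    next
      case False
      with 1(2) have "t \<in> minimal_monomials U"
        by (auto simp: minimal_monomials_def subset_mset.less_le)
      then show ?thesis by blast
    qed
  qed
  with that show ?thesis by blast
qed

lemma multiples_minimal_monomials:
  assumes "monomial_upset V U"
  shows "multiples V (minimal_monomials U) = U"
proof (intro equalityI subsetI)
  fix t assume "t \<in> multiples V (minimal_monomials U)"
  with assms show "t \<in> U"
    by (auto simp: multiples_def monomial_upset_def minimal_monomials_def)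
next
  fix t assume t: "t \<in> U"
  then obtain u where "u \<in> minimal_monomials U" "u \<subseteq># t"
    by (rule minimal_monomial_below)
  with t assms show "t \<in> multiples V (minimal_monomials U)"
    by (auto simp: multiples_def monomial_upset_def)
qed

text \<open>
  A set of pairwise incomparable monomials is the set of minimal elements of its multiples.
  The minimal generators of an ideal generated by some of the minimal generators of \<open>I\<close> are thus
  exactly those chosen.
\<close>

lemma minimal_monomials_multiples:
  assumes "A \<subseteq> minimal_monomials U" "\<And>a. a \<in> A \<Longrightarrow> set_mset a \<subseteq> V"
  shows "minimal_monomials (multiples V A) = A"
proof (intro equalityI subsetI)
  fix t assume t: "t \<in> minimal_monomials (multiples V A)"
  then obtain a where "a \<in> A" "a \<subseteq># t"
    by (auto simp: minimal_monomials_def multiples_def)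
  moreover from this have "a \<in> multiples V A"
    using assms(2) by (auto simp: multiples_def)
  ultimately show "t \<in> A"
    using t by (auto simp: minimal_monomials_def)
next
  fix t assume t: "t \<in> A"
  have "u = t" if "u \<in> multiples V A" "u \<subseteq># t" for u
  proof -
    from that obtain a where a: "a \<in> A" "a \<subseteq># u"
      by (auto simp: multiples_def)
    then have "a = t"
      using that t assms(1) unfolding minimal_monomials_def by (blast intro: subset_mset.trans)
    with a that show ?thesis by simp
  qed
  with t assms(2) show "t \<in> minimal_monomials (multiples V A)"
    by (auto simp: minimal_monomials_def multiples_def)
qed

text \<open>
  A set \<open>A\<close> of monomials generates the ideal iff \<open>U\<close> consists of the multiples of \<open>A\<close>. Then \<open>A\<close>
  contains every minimal element of \<open>U\<close>, and these alone suffice; so they form the only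
  irredundant set of generating monomials.
\<close>

lemma min_gens_monomial_span:
  assumes U: "monomial_upset V U"
  shows "min_gens (poly_ring V) (monomial_span U :: ('v, 'k :: field) mpoly set) = minimal_monomials U"
proof -
  let ?R = "poly_ring V :: ('v, 'k) mpoly ring"
  have gen: "monomial_span U = Idl\<^bsub>?R\<^esub> (monomial ` A) \<longleftrightarrow> U = multiples V A"
    if "\<And>a. a \<in> A \<Longrightarrow> set_mset a \<subseteq> V" for A
    using that by (simp add: Idl_monomials monomial_span_eq_iff)
  have min_sub: "minimal_monomials U \<subseteq> A" if "U = multiples V A" "\<And>a. a \<in> A \<Longrightarrow> set_mset a \<subseteq> V" for A
  proof
    fix t assume t: "t \<in> minimal_monomials U"
    then have "t \<in> multiples V A"
      using that(1) by (auto simp: minimal_monomials_def)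
    then obtain a where "a \<in> A" "a \<subseteq># t"
      by (auto simp: multiples_def)
    moreover from this have "a \<in> U"
      using that by (auto simp: multiples_def)
    ultimately show "t \<in> A"
      using t by (auto simp: minimal_monomials_def)
  qed
  have min_V: "set_mset a \<subseteq> V" if "a \<in> minimal_monomials U" for a
    using that U by (auto simp: minimal_monomials_def monomial_upset_def)
  have iff: "is_min_gens ?R (monomial_span U) A \<longleftrightarrow> A = minimal_monomials U" for A
  proof
    assume A: "is_min_gens ?R (monomial_span U) A"
    then have A_carrier: "monomial ` A \<subseteq> carrier ?R"
        and A_gen: "monomial_span U = Idl\<^bsub>?R\<^esub> (monomial ` A)"
        and A_min: "\<And>B. B \<subset> A \<Longrightarrow> monomial_span U \<noteq> Idl\<^bsub>?R\<^esub> (monomial ` B)"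
      unfolding is_min_gens_def by blast+
    from A_carrier have A_V: "set_mset a \<subseteq> V" if "a \<in> A" for a
      using that by (auto simp: carrier_poly_ring image_subset_iff)
    then have "U = multiples V A"
      using gen[of A] A_gen by blast
    with A_V have "minimal_monomials U \<subseteq> A"
      using min_sub by blast
    moreover have "monomial_span U = Idl\<^bsub>?R\<^esub> (monomial ` minimal_monomials U)"
      using gen[of "minimal_monomials U"] min_V multiples_minimal_monomials[OF U] by simp
    then have "\<not> minimal_monomials U \<subset> A"
      using A_min by blast
    ultimately show "A = minimal_monomials U" by blast
  next
    assume A: "A = minimal_monomials U"
    have "monomial_span U \<noteq> Idl\<^bsub>?R\<^esub> (monomial ` B)" if "B \<subset> A" for B
    proof
      have B_V: "set_mset b \<subseteq> V" if "b \<in> B" for b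
        using that \<open>B \<subset> A\<close> A min_V by blast
      assume "monomial_span U = Idl\<^bsub>?R\<^esub> (monomial ` B)"
      then have "U = multiples V B"
        using gen[of B] B_V by simp
      then have "minimal_monomials U \<subseteq> B"
        using min_sub[of B] B_V by simp
      with that A show False by simp
    qed
    moreover have "monomial ` A \<subseteq> carrier ?R"
      using A min_V by (auto simp: carrier_poly_ring)
    moreover have "monomial_span U = Idl\<^bsub>?R\<^esub> (monomial ` A)"
      using A gen[of A] min_V multiples_minimal_monomials[OF U] by simp
    ultimately show "is_min_gens ?R (monomial_span U) A"
      unfolding is_min_gens_def by blast
  qed
  show ?thesis
    unfolding min_gens_def by (rule the_equality) (simp_all only: iff)
qed

lemma monomial_ideal_monomial_span:
  assumes "monomial_upset V U"
  shows "monomial_ideal (poly_ring V) (monomial_span U :: ('v, 'k :: field) mpoly set)"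
proof -
  have "set_mset a \<subseteq> V" if "a \<in> minimal_monomials U" for a
    using that assms by (auto simp: minimal_monomials_def monomial_upset_def)
  then show ?thesis
    unfolding monomial_ideal_def
    by (intro exI[of _ "minimal_monomials U"])
      (auto simp: Idl_monomials multiples_minimal_monomials[OF assms] carrier_poly_ring)
qed

section \<open>Localization at a prime ideal\<close>

lemma (in primeideal) pow_in_prime:
  fixes n :: nat
  assumes "a \<in> carrier R" "a [^] n \<in> I"
  shows "a \<in> I"
  using assms(2)
proof (induction n)
  case 0
  then show ?case
    using one_imp_carrier I_notcarr by simp
next
  case (Suc n)
  then show ?case
    using I_prime[of "a [^] n" a] assms(1) by auto
qed

lemma primeideal_primary:
  assumes "primeideal Q R"
  shows "primary_ideal R Q"
proof -
  interpret primeideal Q R by fact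
  have "b \<in> radical R Q" if "b \<in> Q" for b
    using that by (auto simp: radical_def intro!: exI[of _ "1 :: nat"])
  then show ?thesis
    using I_prime I_notcarr is_ideal by (auto simp: primary_ideal_def)
qed

text \<open>
  The identification of \<open>I\<^bsub>\<subseteq>Q\<^esub>\<close> with the contraction of the localization of \<open>I\<close> at \<open>Q\<close> shows that it
  does not depend on the primary decomposition picked by the choice operator. A component \<open>J\<close> with
  radical outside \<open>Q\<close> contains an element outside \<open>Q\<close>; the product of finitely many of these moves
  \<open>f\<close> into all such components. Conversely, \<open>g \<notin> Q\<close> can be cancelled in a component whose radical
  lies in \<open>Q\<close>.
\<close>

lemma component_below_eq:
  assumes "primeideal Q R" and dec: "primary_decomposition R I D0"
  shows "component_below R I Q = {f \<in> carrier R. \<exists>g \<in> carrier R - Q. g \<otimes>\<^bsub>R\<^esub> f \<in> I}"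
proof -
  interpret Q: primeideal Q R by fact
  define D where "D = (SOME D. primary_decomposition R I D)"
  have "primary_decomposition R I D"
    unfolding D_def using dec by (rule someI)
  then have fin: "finite D" and prim: "\<And>J. J \<in> D \<Longrightarrow> primary_ideal R J" and I: "I = carrier R \<inter> \<Inter>D"
    by (auto simp: primary_decomposition_def)
  have clear: "\<exists>g \<in> carrier R - Q. \<forall>J \<in> E. g \<in> J"
    if "finite E" "E \<subseteq> {J \<in> D. \<not> radical R J \<subseteq> Q}" for E
    using that
  proof (induction E rule: finite_induct)
    case empty
    show ?case
      using Q.one_imp_carrier Q.I_notcarr by (intro bexI[of _ "\<one>\<^bsub>R\<^esub>"]) auto
  next
    case (insert J E)
    then obtain g where g: "g \<in> carrier R - Q" "\<forall>J \<in> E. g \<in> J" by auto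
    from insert.prems obtain a where "a \<in> radical R J" "a \<notin> Q" by auto
    then obtain n :: nat where a: "a \<in> carrier R" "a [^]\<^bsub>R\<^esub> n \<in> J" "a [^]\<^bsub>R\<^esub> n \<in> carrier R" "a \<notin> Q"
      by (auto simp: radical_def)
    then have "a [^]\<^bsub>R\<^esub> n \<notin> Q"
      using Q.pow_in_prime by blast
    let ?h = "g \<otimes>\<^bsub>R\<^esub> a [^]\<^bsub>R\<^esub> n"
    have id: "ideal K R" if "K \<in> insert J E" for K
      using that insert.prems prim by (auto simp: primary_ideal_def)
    have "?h \<in> carrier R - Q"
      using g a \<open>a [^]\<^bsub>R\<^esub> n \<notin> Q\<close> Q.I_prime[of g "a [^]\<^bsub>R\<^esub> n"] by auto
    moreover have "?h \<in> K" if K: "K \<in> insert J E" for K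
      using K g a ideal.I_l_closed[OF id[OF K]] ideal.I_r_closed[OF id[OF K]] by auto
    ultimately show ?case by blast
  qed
  show ?thesis
  proof (intro equalityI subsetI)
    fix f assume "f \<in> component_below R I Q"
    then have f: "f \<in> carrier R" "\<And>J. J \<in> D \<Longrightarrow> radical R J \<subseteq> Q \<Longrightarrow> f \<in> J"
      by (auto simp: component_below_def D_def)
    obtain g where g: "g \<in> carrier R - Q" "\<And>J. J \<in> D \<Longrightarrow> \<not> radical R J \<subseteq> Q \<Longrightarrow> g \<in> J"
      using clear[of "{J \<in> D. \<not> radical R J \<subseteq> Q}"] fin by auto
    have "g \<otimes>\<^bsub>R\<^esub> f \<in> J" if "J \<in> D" for J
    proof -
      have "ideal J R"
        using prim[OF that] by (simp add: primary_ideal_def)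
      then show ?thesis
        using that f g by (cases "radical R J \<subseteq> Q") (auto intro: ideal.I_l_closed ideal.I_r_closed)
    qed
    then show "f \<in> {f \<in> carrier R. \<exists>g \<in> carrier R - Q. g \<otimes>\<^bsub>R\<^esub> f \<in> I}"
      using f g I by auto
  next
    fix f assume "f \<in> {f \<in> carrier R. \<exists>g \<in> carrier R - Q. g \<otimes>\<^bsub>R\<^esub> f \<in> I}"
    then obtain g where f: "f \<in> carrier R" and g: "g \<in> carrier R" "g \<notin> Q" "g \<otimes>\<^bsub>R\<^esub> f \<in> I"
      by auto
    have "f \<in> J" if "J \<in> D" "radical R J \<subseteq> Q" for J
    proof -
      have "f \<otimes>\<^bsub>R\<^esub> g \<in> J"
        using that f g I Q.m_comm by auto
      with f g that prim[OF that(1)] show ?thesis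
        unfolding primary_ideal_def by blast
    qed
    with f show "f \<in> component_below R I Q"
      by (auto simp: component_below_def D_def)
  qed
qed


section \<open>Symbolic powers of the edge ideal of a complete graph\<close>

text \<open>
  Monomials of degree at least \<open>s\<close> in the variables other than \<open>x\<^sub>i\<close>. The condition is stated as a
  sum, since \<open>size t - count t i\<close> is a truncated subtraction.
\<close>

definition degree_off_ge :: "'v set \<Rightarrow> 'v \<Rightarrow> nat \<Rightarrow> 'v multiset set" where
  "degree_off_ge V i s = {t. set_mset t \<subseteq> V \<and> s + count t i \<le> size t}"

lemma degree_off_ge_1_iff:
  "t \<in> degree_off_ge V i (Suc 0) \<longleftrightarrow> set_mset t \<subseteq> V \<and> (\<exists>j \<in># t. j \<noteq> i)"
proof -
  have "1 + count t i \<le> size t \<longleftrightarrow> (\<exists>j \<in># t. j \<noteq> i)"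
  proof
    assume lt: "1 + count t i \<le> size t"
    show "\<exists>j \<in># t. j \<noteq> i"
    proof (rule ccontr)
      assume "\<not> ?thesis"
      then have "set_mset t \<subseteq> {i}" by auto
      then have "t = replicate_mset (size t) i"
        by (rule set_mset_subset_singletonD)
      then have "count t i = size t"
        by (metis count_replicate_mset)
      with lt show False by simp
    qed
  next
    assume "\<exists>j \<in># t. j \<noteq> i"
    then obtain j where "j \<in># t" "j \<noteq> i" by blast
    then obtain u where "t = add_mset j u"
      by (meson multi_member_split)
    with \<open>j \<noteq> i\<close> count_le_size[of u i] show "1 + count t i \<le> size t" by simp
  qed
  then show ?thesis by (simp add: degree_off_ge_def)
qed

lemma degree_off_ge_upset: "monomial_upset V (degree_off_ge V i s)"
proof -
  have "s + count u i \<le> size u" if "s + count t i \<le> size t" "t \<subseteq># u" for t u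
  proof -
    from that obtain w where "u = t + w"
      by (metis subset_mset.less_eqE)
    with that count_le_size[of w i] show ?thesis by simp
  qed
  then show ?thesis
    by (auto simp: monomial_upset_def degree_off_ge_def)
qed

text \<open>
  The prime ideal generated by the variables other than \<open>x\<^sub>i\<close>.
\<close>

definition coordinate_prime :: "'v set \<Rightarrow> 'v \<Rightarrow> ('v, 'k :: field) mpoly set" where
  "coordinate_prime V i = monomial_span (degree_off_ge V i (Suc 0))"

lemma coordinate_prime_ideal: "ideal (coordinate_prime V i :: ('v, 'k :: field) mpoly set) (poly_ring V)"
  unfolding coordinate_prime_def by (intro monomial_span_ideal degree_off_ge_upset)

text \<open>
  A monomial of degree at least \<open>s + 1\<close> in the variables other than \<open>x\<^sub>i\<close> is such a variable times a
  monomial of degree at least \<open>s\<close> in them.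
\<close>

lemma coordinate_prime_power:
  "coordinate_prime V i [^]\<^bsub>ideals_set (poly_ring V)\<^esub> s =
     (monomial_span (degree_off_ge V i s) :: ('v, 'k :: field) mpoly set)"
proof (induction s)
  case 0
  have "degree_off_ge V i 0 = {t. set_mset t \<subseteq> V}"
    by (auto simp: degree_off_ge_def count_le_size)
  then show ?case
    by (simp add: nat_pow_def ideals_set_def carrier_poly_ring)
next
  case (Suc s)
  let ?R = "poly_ring V :: ('v, 'k) mpoly ring"
  have eq: "degree_off_ge V i (Suc s) = {t + u | t u. t \<in> degree_off_ge V i s \<and> u \<in> degree_off_ge V i (Suc 0)}"
  proof (intro equalityI subsetI)
    fix t assume t: "t \<in> degree_off_ge V i (Suc s)"
    then have "t \<in> degree_off_ge V i (Suc 0)"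
      by (auto simp: degree_off_ge_def)
    then obtain j u where j: "t = add_mset j u" "j \<noteq> i"
      unfolding degree_off_ge_1_iff by (meson multi_member_split)
    with t have "u \<in> degree_off_ge V i s" "{#j#} \<in> degree_off_ge V i (Suc 0)"
      by (auto simp: degree_off_ge_def)
    moreover have "t = u + {#j#}" using j by simp
    ultimately show "t \<in> {t + u | t u. t \<in> degree_off_ge V i s \<and> u \<in> degree_off_ge V i (Suc 0)}"
      by blast
  qed (auto simp: degree_off_ge_def)
  have "coordinate_prime V i [^]\<^bsub>ideals_set ?R\<^esub> Suc s =
      ideal_prod ?R (coordinate_prime V i [^]\<^bsub>ideals_set ?R\<^esub> s) (coordinate_prime V i)"
    by (simp add: nat_pow_def ideals_set_def)
  also have "\<dots> = monomial_span (degree_off_ge V i (Suc s))"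
    by (subst Suc.IH, unfold coordinate_prime_def, rule monomial_span_ideal_prod[OF _ eq])
      (auto simp: degree_off_ge_def)
  finally show ?case .
qed

lemma replicate_mset_plus: "replicate_mset (m + n) x = replicate_mset m x + replicate_mset n x"
  by (rule multiset_eqI) simp

text \<open>
  A polynomial lies outside the ideal iff some power of \<open>x\<^sub>i\<close> occurs in it. If \<open>x\<^sub>i\<^sup>a\<close> and \<open>x\<^sub>i\<^sup>b\<close> are
  the least powers occurring in \<open>f\<close> and \<open>g\<close>, then the coefficient of \<open>x\<^sub>i\<^bsup>a + b\<^esup>\<close> in \<open>f g\<close> is the product
  of the two coefficients, because every other factorization of this monomial involves a smaller
  power in one of the factors.
\<close>

lemma coordinate_prime_primeideal:
  assumes "i \<in> V"
  shows "primeideal (coordinate_prime V i :: ('v, 'k :: field) mpoly set) (poly_ring V)"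
proof (rule primeidealI)
  let ?R = "poly_ring V :: ('v, 'k) mpoly ring"
  let ?Q = "coordinate_prime V i :: ('v, 'k) mpoly set"
  have one: "(1 :: ('v, 'k) mpoly) \<in> carrier ?R" "(1 :: ('v, 'k) mpoly) \<notin> ?Q"
    by (auto simp: carrier_poly_ring monomial_span_def coordinate_prime_def degree_off_ge_1_iff)
  then show "carrier ?R \<noteq> ?Q" by blast
  have notin: "\<exists>n. Poly_Mapping.lookup f (replicate_mset n i) \<noteq> 0"
    if "f \<in> carrier ?R" "f \<notin> ?Q" for f
  proof -
    from that obtain t where t: "t \<in> Poly_Mapping.keys f" "\<forall>j \<in># t. j = i"
      by (force simp: carrier_poly_ring monomial_span_def coordinate_prime_def degree_off_ge_1_iff)
    then have "t = replicate_mset (size t) i"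
      by (intro set_mset_subset_singletonD) auto
    with t show ?thesis
      by (metis in_keys_iff)
  qed
  fix f g assume fg: "f \<in> carrier ?R" "g \<in> carrier ?R" "f \<otimes>\<^bsub>?R\<^esub> g \<in> ?Q"
  show "f \<in> ?Q \<or> g \<in> ?Q"
  proof (rule ccontr)
    assume nin: "\<not> ?thesis"
    \<comment> \<open>lowest powers of \<open>x\<^sub>i\<close> that occur in \<open>f\<close> and \<open>g\<close>\<close>
    define a where "a = (LEAST n. Poly_Mapping.lookup f (replicate_mset n i) \<noteq> 0)"
    define b where "b = (LEAST n. Poly_Mapping.lookup g (replicate_mset n i) \<noteq> 0)"
    have a: "Poly_Mapping.lookup f (replicate_mset a i) \<noteq> 0"
      unfolding a_def by (rule LeastI_ex, rule notin) (use fg nin in blast)+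
    have b: "Poly_Mapping.lookup g (replicate_mset b i) \<noteq> 0"
      unfolding b_def by (rule LeastI_ex, rule notin) (use fg nin in blast)+
    have a_min: "Poly_Mapping.lookup f (replicate_mset n i) = 0" if "n < a" for n
      using not_less_Least[OF that[unfolded a_def]] by simp
    have b_min: "Poly_Mapping.lookup g (replicate_mset n i) = 0" if "n < b" for n
      using not_less_Least[OF that[unfolded b_def]] by simp
    let ?k = "replicate_mset (a + b) i"
    have "Poly_Mapping.lookup f l * (\<Sum>q. Poly_Mapping.lookup g q when ?k = l + q) =
        (Poly_Mapping.lookup f l * Poly_Mapping.lookup g (replicate_mset b i) when l = replicate_mset a i)" for l
    proof (cases "l \<subseteq># ?k")
      case False
      then have "?k \<noteq> l + q" for q
        by (metis mset_subset_eq_add_left)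
      moreover have "l \<noteq> replicate_mset a i"
        using False by (auto simp: replicate_mset_plus)
      ultimately show ?thesis by simp
    next
      case True
      define n where "n = size l"
      have "set_mset l \<subseteq> {i}"
        using set_mset_mono[OF True] by (auto split: if_splits)
      then have l: "l = replicate_mset n i"
        unfolding n_def by (rule set_mset_subset_singletonD)
      have n: "n \<le> a + b"
        using size_mset_mono[OF True] n_def by simp
      then have k: "?k = l + replicate_mset (a + b - n) i"
        by (simp add: l flip: replicate_mset_plus)
      have "(\<Sum>q. Poly_Mapping.lookup g q when ?k = l + q) =
          (\<Sum>q. Poly_Mapping.lookup g q when q = replicate_mset (a + b - n) i)"
        by (simp add: k eq_commute)
      also have "\<dots> = Poly_Mapping.lookup g (replicate_mset (a + b - n) i)"
        by simp
      finally have eq: "(\<Sum>q. Poly_Mapping.lookup g q when ?k = l + q) =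
        Poly_Mapping.lookup g (replicate_mset (a + b - n) i)" .
      consider "n < a" | "n = a" | "n > a" by linarith
      then show ?thesis
      proof cases
        case 3
        then have "a + b - n < b" using n by simp
        then have "Poly_Mapping.lookup g (replicate_mset (a + b - n) i) = 0" by (rule b_min)
        with 3 show ?thesis unfolding eq using replicate_mset_eq_iff[of n i a i] by (auto simp: l when_def)
      qed (unfold eq, auto simp: l a_min when_def)
    qed
    then have "Poly_Mapping.lookup (f * g) ?k =
        Poly_Mapping.lookup f (replicate_mset a i) * Poly_Mapping.lookup g (replicate_mset b i)"
      by (simp add: lookup_mult)
    with a b have "?k \<in> Poly_Mapping.keys (f * g)"
      by (simp add: in_keys_iff)
    moreover have "?k \<notin> degree_off_ge V i (Suc 0)"
      by (simp add: degree_off_ge_def)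
    ultimately show False
      using fg by (auto simp: coordinate_prime_def monomial_span_def)
  qed
qed (simp_all add: coordinate_prime_ideal poly_ring_cring)

lemma indet_in_coordinate_prime_iff:
  assumes "j \<in> V"
  shows "(indet j :: ('v, 'k :: field) mpoly) \<in> coordinate_prime V i \<longleftrightarrow> j \<noteq> i"
  using assms by (simp add: indet_def coordinate_prime_def degree_off_ge_1_iff)

lemma coordinate_prime_subset_iff:
  assumes "i \<in> V" "j \<in> V"
  shows "(coordinate_prime V i :: ('v, 'k :: field) mpoly set) \<subseteq> coordinate_prime V j \<longleftrightarrow> i = j"
proof -
  have "(indet j :: ('v, 'k) mpoly) \<in> coordinate_prime V i \<longleftrightarrow> i \<noteq> j"
    and "(indet j :: ('v, 'k) mpoly) \<notin> coordinate_prime V j"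
    using indet_in_coordinate_prime_iff[OF assms(2)] by auto
  then show ?thesis by auto
qed

lemma indet_in_carrier: "j \<in> V \<Longrightarrow> (indet j :: ('v, 'k :: field) mpoly) \<in> carrier (poly_ring V)"
  by (simp add: indet_def carrier_poly_ring)

text \<open>
  A monomial is a multiple of some edge \<open>x\<^sub>u x\<^sub>v\<close> iff it involves two variables, that is, iff for
  each \<open>i\<close> it involves a variable other than \<open>x\<^sub>i\<close>.
\<close>

lemma edge_ideal_complete_graph:
  fixes V :: "'v set"
  assumes "V \<noteq> {}"
  shows "edge_ideal (poly_ring V) (complete_graph V) =
    (\<Inter>i \<in> V. coordinate_prime V i :: ('v, 'k :: field) mpoly set)"
proof -
  let ?E = "{{#u, v#} | u v. u \<in> V \<and> v \<in> V \<and> u \<noteq> v}"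
  have "{u, v} \<in> snd (complete_graph V) \<longleftrightarrow> u \<in> V \<and> v \<in> V \<and> u \<noteq> v" for u v
    by (simp add: complete_graph_def card_insert_if)
  moreover have "indet u * indet v = (monomial {#u, v#} :: ('v, 'k) mpoly)" for u v
    by (simp add: indet_def monomial_mult add_mset_commute)
  ultimately have "{indet u * indet v | u v. {u, v} \<in> snd (complete_graph V)} =
      {monomial {#u, v#} :: ('v, 'k) mpoly | u v. u \<in> V \<and> v \<in> V \<and> u \<noteq> v}"
    by (simp only:)
  also have "\<dots> = monomial ` ?E" by blast
  finally have "edge_ideal (poly_ring V) (complete_graph V) =
      (Idl\<^bsub>poly_ring V\<^esub> (monomial ` ?E) :: ('v, 'k) mpoly set)"
    by (simp only: edge_ideal_def)
  also have "\<dots> = monomial_span (multiples V ?E)"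
    by (rule Idl_monomials) auto
  also have "multiples V ?E = (\<Inter>i \<in> V. degree_off_ge V i (Suc 0))"
  proof (intro equalityI subsetI)
    fix t assume "t \<in> multiples V ?E"
    then obtain u v where "u \<noteq> v" "{#u, v#} \<subseteq># t" "set_mset t \<subseteq> V"
      by (auto simp: multiples_def)
    then have "u \<in># t" "v \<in># t"
      by (auto simp: insert_subset_eq_iff dest: in_diffD)
    with \<open>u \<noteq> v\<close> have "\<exists>j \<in># t. j \<noteq> i" for i by metis
    with \<open>set_mset t \<subseteq> V\<close> show "t \<in> (\<Inter>i \<in> V. degree_off_ge V i (Suc 0))"
      by (simp add: degree_off_ge_1_iff)
  next
    fix t assume t: "t \<in> (\<Inter>i \<in> V. degree_off_ge V i (Suc 0))"
    with assms have t_V: "set_mset t \<subseteq> V"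
      by (auto simp: degree_off_ge_def)
    have other: "\<exists>j \<in># t. j \<noteq> i" if "i \<in> V" for i
      using t that by (simp add: degree_off_ge_1_iff)
    with assms obtain u where u: "u \<in># t" by blast
    with t_V have "u \<in> V" by blast
    from other[OF this] obtain v where v: "v \<in># t" "v \<noteq> u" by blast
    from u v have "{#u, v#} \<subseteq># t"
      by (simp add: insert_subset_eq_iff in_diff_count)
    with u v t_V show "t \<in> multiples V ?E"
      by (auto simp: multiples_def)
  qed
  also have "monomial_span \<dots> = (\<Inter>i \<in> V. coordinate_prime V i :: ('v, 'k) mpoly set)"
    using assms by (auto simp: monomial_span_def coordinate_prime_def)
  finally show ?thesis .
qed

text \<open>
  Both the annihilator of \<open>x\<^sub>i\<close> modulo the edge ideal and the contraction of its localization at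
  \<open>coordinate_prime V i\<close> are computed from this product.
\<close>

lemma indet_mult_in_edge_ideal:
  assumes "i \<in> V" and "g \<in> coordinate_prime V i"
  shows "g * indet i \<in> (\<Inter>j \<in> V. coordinate_prime V j :: ('v, 'k :: field) mpoly set)"
proof
  fix j assume "j \<in> V"
  let ?Q = "coordinate_prime V j :: ('v, 'k) mpoly set"
  interpret ideal ?Q "poly_ring V" by (rule coordinate_prime_ideal)
  have g: "g \<in> carrier (poly_ring V)"
    by (rule ideal.Icarr[OF coordinate_prime_ideal assms(2)])
  show "g * indet i \<in> ?Q"
  proof (cases "i = j")
    case True
    then have "g \<in> ?Q" using assms(2) by simp
    from I_r_closed[OF this indet_in_carrier[OF assms(1)]] show ?thesis by simp
  next
    case False
    then have "indet i \<in> ?Q"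
      using indet_in_coordinate_prime_iff[OF assms(1)] by blast
    from I_l_closed[OF this g] show ?thesis by simp
  qed
qed

text \<open>
  Let \<open>Q = (I : f)\<close> be an associated prime. As \<open>f\<close> lies outside \<open>I\<close>, it lies outside some
  \<open>coordinate_prime V j\<close>, which therefore contains \<open>Q\<close>. In particular \<open>x\<^sub>j \<notin> Q\<close>, and as \<open>x\<^sub>l x\<^sub>j \<in> I \<subseteq> Q\<close>
  for \<open>l \<noteq> j\<close>, all other variables lie in \<open>Q\<close>. Conversely, \<open>coordinate_prime V i = (I : x\<^sub>i)\<close>.
\<close>

lemma associated_primes_edge_ideal:
  fixes V :: "'v set"
  shows "associated_primes (poly_ring V) (\<Inter>i \<in> V. coordinate_prime V i) =
    (coordinate_prime V ` V :: ('v, 'k :: field) mpoly set set)"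
proof (intro equalityI subsetI)
  let ?R = "poly_ring V :: ('v, 'k) mpoly ring"
  let ?I = "\<Inter>i \<in> V. coordinate_prime V i :: ('v, 'k) mpoly set"
  fix Q assume "Q \<in> associated_primes ?R ?I"
  then obtain f where "primeideal Q ?R" and f: "f \<in> carrier ?R" and Q: "Q = {g \<in> carrier ?R. g * f \<in> ?I}"
    by (auto simp: associated_primes_def)
  interpret Q: primeideal Q ?R by fact
  have "f \<notin> ?I"
  proof
    assume "f \<in> ?I"
    then have "1 \<in> Q"
      unfolding Q using Q.one_closed by simp
    then show False
      using Q.one_imp_carrier Q.I_notcarr by simp
  qed
  then obtain j where j: "j \<in> V" "f \<notin> coordinate_prime V j" by blast
  have Q_le: "Q \<subseteq> coordinate_prime V j"
  proof
    fix g assume "g \<in> Q"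
    then have "g \<in> carrier ?R" "g \<otimes>\<^bsub>?R\<^esub> f \<in> coordinate_prime V j"
      unfolding Q using j(1) by auto
    with primeideal.I_prime[OF coordinate_prime_primeideal[OF j(1)] _ f] j(2)
    show "g \<in> coordinate_prime V j" by blast
  qed
  have "indet l \<in> Q" if l: "l \<in> V" "l \<noteq> j" for l
  proof -
    have "(indet l :: ('v, 'k) mpoly) \<in> coordinate_prime V j"
      using l by (simp add: indet_in_coordinate_prime_iff)
    then have "indet l * indet j \<in> ?I"
      by (rule indet_mult_in_edge_ideal[OF j(1)])
    then have "f \<otimes>\<^bsub>?R\<^esub> (indet l * indet j) \<in> ?I"
      using ideal.I_l_closed[OF coordinate_prime_ideal _ f] by blast
    then have "indet l * indet j * f \<in> ?I"
      by (simp add: mult.commute)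
    moreover have "indet l * indet j \<in> carrier ?R"
      using Q.m_closed[OF indet_in_carrier[OF l(1)] indet_in_carrier[OF j(1)]] by simp
    ultimately have "indet l * indet j \<in> Q"
      unfolding Q by blast
    then have "indet l \<in> Q \<or> indet j \<in> Q"
      using Q.I_prime[OF indet_in_carrier[OF l(1)] indet_in_carrier[OF j(1)]] by simp
    moreover have "indet j \<notin> Q"
      using Q_le indet_in_coordinate_prime_iff[OF j(1), of j] by blast
    ultimately show ?thesis by blast
  qed
  then have gens: "monomial ` {{#l#} | l. l \<in> V \<and> l \<noteq> j} \<subseteq> Q"
    by (auto simp: indet_def)
  have "(coordinate_prime V j :: ('v, 'k) mpoly set) =
      monomial_span (multiples V {{#l#} | l. l \<in> V \<and> l \<noteq> j})"
    unfolding coordinate_prime_def monomial_span_eq_iff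
    by (auto simp: degree_off_ge_1_iff multiples_def) (blast intro: single_subset_iff[THEN iffD2])
  then have "coordinate_prime V j = Idl\<^bsub>?R\<^esub> (monomial ` {{#l#} | l. l \<in> V \<and> l \<noteq> j})"
    by (subst Idl_monomials) auto
  with Q.genideal_minimal[OF Q.is_ideal gens] have "coordinate_prime V j \<subseteq> Q"
    by simp
  with Q_le j show "Q \<in> coordinate_prime V ` V" by blast
next
  let ?R = "poly_ring V :: ('v, 'k) mpoly ring"
  let ?I = "\<Inter>i \<in> V. coordinate_prime V i :: ('v, 'k) mpoly set"
  fix Q :: "('v, 'k) mpoly set" assume "Q \<in> coordinate_prime V ` V"
  then obtain i where i: "i \<in> V" "Q = coordinate_prime V i" by blast
  interpret Q: primeideal Q ?R
    unfolding i by (rule coordinate_prime_primeideal) (rule i)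
  have "g \<in> Q \<longleftrightarrow> g \<in> carrier ?R \<and> g * indet i \<in> ?I" for g
  proof
    assume "g \<in> Q"
    then show "g \<in> carrier ?R \<and> g * indet i \<in> ?I"
      using indet_mult_in_edge_ideal[OF i(1), of g] Q.Icarr unfolding i(2) by blast
  next
    assume g: "g \<in> carrier ?R \<and> g * indet i \<in> ?I"
    then have "g \<otimes>\<^bsub>?R\<^esub> indet i \<in> Q"
      using i by simp
    then have "g \<in> Q \<or> indet i \<in> Q"
      using Q.I_prime[OF _ indet_in_carrier[OF i(1)]] g by blast
    then show "g \<in> Q"
      using indet_in_coordinate_prime_iff[OF i(1), of i] unfolding i(2) by blast
  qed
  then have "Q = {g \<in> carrier ?R. g \<otimes>\<^bsub>?R\<^esub> indet i \<in> ?I}"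
    unfolding poly_ring_ops by blast
  then show "Q \<in> associated_primes ?R ?I"
    using Q.primeideal_axioms indet_in_carrier[OF i(1)] unfolding associated_primes_def by blast
qed

text \<open>
  No coordinate prime contains another one, so all of them are maximal among the associated primes,
  and the localization at each of them turns the edge ideal into that prime. The symbolic power is
  therefore the intersection of the powers of the coordinate primes.
\<close>

lemma symbolic_power_edge_ideal:
  fixes V :: "'v set"
  assumes "finite V" "V \<noteq> {}"
  shows "symbolic_power (poly_ring V) (edge_ideal (poly_ring V) (complete_graph V)) s =
    (monomial_span (\<Inter>i \<in> V. degree_off_ge V i s) :: ('v, 'k :: field) mpoly set)"
proof -
  let ?R = "poly_ring V :: ('v, 'k) mpoly ring"
  let ?Q = "\<lambda>i. coordinate_prime V i :: ('v, 'k) mpoly set"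
  let ?I = "\<Inter>i \<in> V. ?Q i"
  have edge: "edge_ideal ?R (complete_graph V) = ?I"
    using \<open>V \<noteq> {}\<close> by (rule edge_ideal_complete_graph)
  have "max_associated_primes ?R ?I = ?Q ` V"
    unfolding max_associated_primes_def associated_primes_edge_ideal
    by (auto simp: coordinate_prime_subset_iff)
  moreover have "component_below ?R ?I (?Q i) = ?Q i" if i: "i \<in> V" for i
  proof -
    interpret Q: primeideal "?Q i" ?R
      by (rule coordinate_prime_primeideal[OF i])
    have "primary_decomposition ?R ?I (?Q ` V)"
      unfolding primary_decomposition_def
    proof (intro conjI ballI)
      fix J assume "J \<in> ?Q ` V"
      then obtain j where "j \<in> V" "J = ?Q j" by blast
      then show "primary_ideal ?R J"
        by (simp add: primeideal_primary coordinate_prime_primeideal)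
    next
      have "?I \<subseteq> carrier ?R" using i Q.Icarr by blast
      then show "?I = carrier ?R \<inter> \<Inter> (?Q ` V)" by blast
    qed (simp add: \<open>finite V\<close>)
    then have "component_below ?R ?I (?Q i) =
        {f \<in> carrier ?R. \<exists>g \<in> carrier ?R - ?Q i. g * f \<in> ?I}"
      using component_below_eq[OF Q.primeideal_axioms] by simp
    also have "\<dots> = ?Q i"
    proof (intro equalityI subsetI)
      fix f assume "f \<in> {f \<in> carrier ?R. \<exists>g \<in> carrier ?R - ?Q i. g * f \<in> ?I}"
      then obtain g where "f \<in> carrier ?R" "g \<in> carrier ?R" "g \<notin> ?Q i" "g \<otimes>\<^bsub>?R\<^esub> f \<in> ?Q i"
        using i by auto
      then show "f \<in> ?Q i"
        using Q.I_prime by blast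
    next
      fix f assume f: "f \<in> ?Q i"
      then have "indet i * f \<in> ?I"
        using indet_mult_in_edge_ideal[OF i f] by (simp add: mult.commute)
      then show "f \<in> {f \<in> carrier ?R. \<exists>g \<in> carrier ?R - ?Q i. g * f \<in> ?I}"
        using Q.Icarr[OF f] indet_in_carrier[OF i] indet_in_coordinate_prime_iff[OF i, of i] by blast
    qed
    finally show ?thesis .
  qed
  ultimately have "symbolic_power ?R ?I s = carrier ?R \<inter> (\<Inter>i \<in> V. monomial_span (degree_off_ge V i s))"
    unfolding symbolic_power_def coordinate_prime_power[symmetric] by simp
  also have "\<dots> = monomial_span (\<Inter>i \<in> V. degree_off_ge V i s)"
    using \<open>V \<noteq> {}\<close> by (auto simp: carrier_poly_ring monomial_span_def degree_off_ge_def)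
  finally show ?thesis by (simp add: edge)
qed

section \<open>Symbolic powers restricted to multiples of a monomial\<close>

text \<open>
  For \<open>F\<close> the product of the vertices outside \<open>H\<close>, these are the monomials of \<open>I\<^bsub>G\<setminus>H,s\<^esub>\<close>.
\<close>

definition symbolic_multiples :: "'v set \<Rightarrow> 'v multiset \<Rightarrow> nat \<Rightarrow> 'v multiset set" where
  "symbolic_multiples V F s = {t \<in> (\<Inter>i \<in> V. degree_off_ge V i s). F \<subseteq># t}"

lemma mem_symbolic_multiples:
  assumes "V \<noteq> {}"
  shows "t \<in> symbolic_multiples V F s \<longleftrightarrow>
    set_mset t \<subseteq> V \<and> F \<subseteq># t \<and> (\<forall>i \<in> V. s + count t i \<le> size t)"
  using assms by (auto simp: symbolic_multiples_def degree_off_ge_def)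

lemma symbolic_multiples_upset:
  assumes "V \<noteq> {}"
  shows "monomial_upset V (symbolic_multiples V F s)"
  unfolding monomial_upset_def
proof (intro conjI ballI allI impI)
  fix t u assume t: "t \<in> symbolic_multiples V F s" and le: "t \<subseteq># u" and u: "set_mset u \<subseteq> V"
  have "u \<in> degree_off_ge V i s" if "i \<in> V" for i
  proof -
    have "t \<in> degree_off_ge V i s" using t that by (simp add: symbolic_multiples_def)
    from degree_off_ge_upset this le u show ?thesis by (rule monomial_upsetD)
  qed
  moreover have "F \<subseteq># u"
    using t le by (auto simp: symbolic_multiples_def intro: subset_mset.trans)
  ultimately show "u \<in> symbolic_multiples V F s"
    by (simp add: symbolic_multiples_def)
qed (simp add: mem_symbolic_multiples[OF assms])

lemma verts_complete_graph [simp]: "verts (complete_graph V) = V"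
  by (simp add: complete_graph_def)

lemma verts_induced_subgraph [simp]: "verts (induced_subgraph G W) = W"
  by (simp add: induced_subgraph_def)

lemma diff_symbolic_power_complete_graph:
  fixes V W :: "'v set"
  assumes fin: "finite V" and V: "V \<noteq> {}" and W: "W \<subseteq> V"
  shows "diff_symbolic_power (poly_ring V) (complete_graph V) (induced_subgraph (complete_graph V) W) s =
    (monomial_span (symbolic_multiples V (mset_set (V - W)) s) :: ('v, 'k :: field) mpoly set)"
proof (cases "W = V")
  case True
  then have "symbolic_multiples V (mset_set (V - W)) s = (\<Inter>i \<in> V. degree_off_ge V i s)"
    by (auto simp: symbolic_multiples_def)
  with True show ?thesis
    by (simp add: diff_symbolic_power_def symbolic_power_edge_ideal[OF fin V])
next
  case False
  let ?F = "mset_set (V - W)"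
  have "(\<Prod>x \<in> A. indet x) = (monomial (mset_set A) :: ('v, 'k) mpoly)" if "finite A" for A :: "'v set"
    using that
    by (induction A rule: finite_induct) (auto simp: indet_def monomial_mult, simp add: monomial_def)
  then have prod: "{\<Prod>x \<in> V - W. indet x} = (monomial ` {?F} :: ('v, 'k) mpoly set)"
    using fin by simp
  have "Idl\<^bsub>poly_ring V\<^esub> {\<Prod>x \<in> V - W. indet x} = (monomial_span (multiples V {?F}) :: ('v, 'k) mpoly set)"
    unfolding prod using fin by (intro Idl_monomials) auto
  moreover have "(\<Inter>i \<in> V. degree_off_ge V i s) \<inter> multiples V {?F} = symbolic_multiples V ?F s"
    using V by (auto simp: symbolic_multiples_def multiples_def degree_off_ge_def)
  ultimately show ?thesis
    using False by (simp add: diff_symbolic_power_def monomial_span_Int symbolic_power_edge_ideal[OF fin V])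
qed

text \<open>
  A factor \<open>x\<^sub>c\<close> of \<open>v\<close> that is not needed for divisibility by \<open>F\<close> may be traded for the new
  variable \<open>x\<^sub>r\<close>. The degree is preserved and no exponent but that of \<open>x\<^sub>r\<close> grows; the latter becomes
  \<open>1\<close>, which the exponent of \<open>x\<^sub>c\<close> in \<open>v\<close> already reached.
\<close>

lemma symbolic_multiples_exchange:
  assumes v: "v \<in> symbolic_multiples V F s" and r: "r \<in> V" "r \<notin># v" and c: "c \<in># v - F"
    and "s \<ge> 1"
  shows "add_mset r (v - {#c#}) \<in> symbolic_multiples V F s"
proof -
  have V: "V \<noteq> {}" using r by blast
  note mem = mem_symbolic_multiples[OF V]
  have cv: "c \<in># v" using c by (rule in_diffD)
  have size: "size (add_mset r (v - {#c#})) = size v"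
    using cv by (metis insert_DiffM size_add_mset)
  have F: "F \<subseteq># add_mset r (v - {#c#})"
  proof (rule mset_subset_eqI)
    fix x
    have "count F x \<le> count v x"
      using v mset_subset_eq_count[of F v x] by (simp add: mem)
    then show "count F x \<le> count (add_mset r (v - {#c#})) x"
      using c by (cases "x = c") (auto simp: in_diff_count)
  qed
  have "s + count (add_mset r (v - {#c#})) i \<le> size v" if i: "i \<in> V" for i
  proof (cases "i = r")
    case True
    have "c \<noteq> r" using cv r by blast
    have "c \<in> V" using cv v by (auto simp: mem)
    then have "s + count v c \<le> size v" using v by (auto simp: mem)
    moreover have "1 \<le> count v c" using cv by (simp add: Suc_le_eq)
    moreover have "count (add_mset r (v - {#c#})) i = 1"
      using r True \<open>c \<noteq> r\<close> by (simp add: not_in_iff)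
    ultimately show ?thesis by linarith
  next
    case False
    have "s + count v i \<le> size v" using v i by (auto simp: mem)
    with False show ?thesis by (auto simp: count_diff)
  qed
  with F v r size show ?thesis
    by (auto simp: mem dest: in_diffD)
qed

text \<open>
  A minimal generator below the exchanged monomial must involve \<open>x\<^sub>r\<close>, since otherwise it would
  properly divide the minimal generator \<open>v\<close>. This supplies the values of the first component of
  the splitting function.
\<close>

lemma minimal_exchange:
  assumes v: "v \<in> minimal_monomials (symbolic_multiples V F s)" and r: "r \<in> V" "r \<notin># v"
    and c: "c \<in># v - F" and "s \<ge> 1"
  obtains u where "u \<in> minimal_monomials (symbolic_multiples V F s)"
    "u \<subseteq># add_mset r (v - {#c#})" "count u r = 1"
proof -
  let ?U = "symbolic_multiples V F s"
  have cv: "c \<in># v" using c by (rule in_diffD)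
  have "add_mset r (v - {#c#}) \<in> ?U"
    using assms by (intro symbolic_multiples_exchange) (auto simp: minimal_monomials_def)
  then obtain u where u: "u \<in> minimal_monomials ?U" "u \<subseteq># add_mset r (v - {#c#})"
    by (rule minimal_monomial_below)
  have "r \<in># u"
  proof (rule ccontr)
    assume "r \<notin># u"
    have le: "u \<subseteq># v - {#c#}"
    proof (rule mset_subset_eqI)
      fix x
      show "count u x \<le> count (v - {#c#}) x"
        using mset_subset_eq_count[OF u(2), of x] \<open>r \<notin># u\<close>
        by (cases "x = r") (auto simp: not_in_iff)
    qed
    then have "u \<subseteq># v"
      by (meson diff_subset_eq_self subset_mset.trans)
    with u v have "u = v"
      by (auto simp: minimal_monomials_def)
    with le have "size v \<le> size (v - {#c#})"
      by (simp add: size_mset_mono)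
    also have "\<dots> < size v"
      using cv by (rule size_Diff1_less)
    finally show False by simp
  qed
  moreover have "count u r \<le> 1"
    using mset_subset_eq_count[OF u(2), of r] r by (simp add: count_diff not_in_iff)
  ultimately have "count u r = 1"
    by (simp add: Suc_le_eq le_antisym)
  with u that show thesis by blast
qed

text \<open>
  The degree of \<open>v\<close> exceeds \<open>s\<close>, since it is at least \<open>s\<close> plus the exponent of any variable that
  occurs; so \<open>v\<close> is a proper multiple of \<open>F\<close>.
\<close>

lemma symbolic_multiples_excess:
  assumes v: "v \<in> symbolic_multiples V F s" and "V \<noteq> {}" "s \<ge> 1" "size F \<le> s"
  shows "v - F \<noteq> {#}"
proof
  note mem = mem_symbolic_multiples[OF assms(2)]
  assume "v - F = {#}"
  with v have vF: "v = F"
    by (metis Diff_eq_empty_iff_mset mem subset_mset.antisym)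
  obtain i where "i \<in> V" using assms(2) by blast
  with v assms(3) have "v \<noteq> {#}" by (auto simp: mem)
  then obtain j where "j \<in># v" by blast
  with v have "s + count v j \<le> size v" "1 \<le> count v j"
    by (auto simp: mem Suc_le_eq)
  moreover have "size v \<le> s"
    using assms(4) vF by simp
  ultimately show False by linarith
qed

text \<open>
  A bound on the exponents of the minimal generators, which makes every set of them bounded above
  and its \<open>Sup\<close> a genuine least common multiple. If the exponent of \<open>x\<close> exceeds \<open>s\<close>, one factor \<open>x\<close>
  can be removed: the remaining exponent is at least \<open>s\<close>, which suffices both for the degree
  conditions at the other variables and for divisibility by the squarefree \<open>F\<close>.
\<close>

lemma minimal_symbolic_count_le:
  assumes v: "v \<in> minimal_monomials (symbolic_multiples V F s)" and V: "V \<noteq> {}"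
    and s: "s \<ge> 1" and F: "\<And>x. count F x \<le> 1"
  shows "count v x \<le> s"
proof (rule ccontr)
  note mem = mem_symbolic_multiples[OF V]
  assume "\<not> ?thesis"
  then have gt: "count v x > s" by simp
  then have xv: "x \<in># v" by (metis count_greater_zero_iff gr_zeroI not_less_zero)
  have vU: "v \<in> symbolic_multiples V F s"
    using v by (simp add: minimal_monomials_def)
  let ?u = "v - {#x#}"
  have size: "size v = Suc (size ?u)"
    using xv by (metis insert_DiffM size_add_mset)
  have "count F y \<le> count ?u y" for y
    using F[of y] gt s mset_subset_eq_count[of F v y] vU by (auto simp: mem)
  then have "F \<subseteq># ?u" by (rule mset_subset_eqI)
  moreover have "s + count ?u i \<le> size ?u" if i: "i \<in> V" for i
  proof (cases "i = x")
    case True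
    with vU i have "s + count v x \<le> size v" by (auto simp: mem)
    with True gt size show ?thesis by simp
  next
    case False
    have "x \<in> V" using xv vU by (auto simp: mem)
    \<comment> \<open>the degree is at least the sum of the two exponents, and that of \<open>x\<close> exceeds \<open>s\<close>\<close>
    have "replicate_mset (count v x) x + replicate_mset (count v i) i \<subseteq># v"
      using False by (intro mset_subset_eqI) auto
    from size_mset_mono[OF this] have "count v x + count v i \<le> size v" by simp
    with False gt size show ?thesis by simp
  qed
  ultimately have "?u \<in> symbolic_multiples V F s"
    using vU by (auto simp: mem dest: in_diffD)
  moreover have "?u \<subseteq># v" by simp
  ultimately have "?u = v"
    using v unfolding minimal_monomials_def by blast
  with size show False by (metis n_not_Suc_n)
qed

text \<open>
  Let \<open>b\<close> be the least common multiple of \<open>S\<close> and \<open>x\<^sub>c\<close> the least variable of \<open>b - F\<close>. An element of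
  \<open>S\<close> whose exponent at \<open>c\<close> agrees with that of \<open>b\<close> leaves the same least variable when divided by \<open>F\<close>, so
  \<open>\<phi>\<close> lowers the exponent there; every other element of \<open>S\<close> is below \<open>b\<close> at \<open>c\<close> anyway. This is why a
  rule that always lowers the first possible variable satisfies the strictness condition for all
  subsets \<open>S\<close> at once.
\<close>

lemma Sup_lowered_strict:
  fixes F :: "'v :: linorder multiset" and \<phi> :: "'v multiset \<Rightarrow> 'v multiset"
  assumes S: "S \<noteq> {}" and bdd: "subset_mset.bdd_above S"
    and le: "\<And>w. w \<in> S \<Longrightarrow> \<phi> w \<subseteq># w"
    and nonempty: "\<And>w. w \<in> S \<Longrightarrow> w - F \<noteq> {#}"
    and lower: "\<And>w c. w \<in> S \<Longrightarrow> c = Min (set_mset (w - F)) \<Longrightarrow> count (\<phi> w) c < count w c"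
  shows "Sup (\<phi> ` S) \<subset># Sup S"
proof -
  define b where "b = Sup S"
  have up: "w \<subseteq># b" if "w \<in> S" for w
    unfolding b_def using that bdd by (intro subset_mset.cSup_upper)
  have "Sup (\<phi> ` S) \<subseteq># b"
    using S up le by (intro subset_mset.cSup_least) (auto intro: subset_mset.trans)
  moreover have "Sup (\<phi> ` S) \<noteq> b"
  proof
    assume eq: "Sup (\<phi> ` S) = b"
    obtain w0 where "w0 \<in> S" using S by blast
    then have ne: "set_mset (b - F) \<noteq> {}"
      using nonempty[of w0] up[of w0] by (metis Diff_eq_empty_iff_mset set_mset_eq_empty_iff subset_mset.trans)
    define c where "c = Min (set_mset (b - F))"
    have cb: "c \<in># b - F"
      unfolding c_def using ne by (intro Min_in) auto
    have "count (\<phi> w) c < count b c" if w: "w \<in> S" for w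
    proof (cases "count w c = count b c")
      case False
      have "count w c \<le> count b c" "count (\<phi> w) c \<le> count w c"
        using up[OF w] le[OF w] by (simp_all add: mset_subset_eq_count)
      with False show ?thesis by simp
    next
      case True
      then have "c \<in># w - F" using cb by (simp add: in_diff_count)
      moreover have "c \<le> x" if "x \<in># w - F" for x
      proof -
        have "x \<in># b - F"
          using that mset_subset_eq_count[OF up[OF w], of x] by (simp add: in_diff_count)
        then show ?thesis unfolding c_def by (intro Min_le) auto
      qed
      ultimately have "c = Min (set_mset (w - F))"
        by (intro Min_eqI[symmetric]) auto
      from lower[OF w this] True show ?thesis by simp
    qed
    then have "(SUP X\<in>\<phi> ` S. count X c) \<le> count b c - 1"
      using S by (intro cSUP_least) fastforce+
    moreover have "0 < count b c"
      using cb in_diff_count[of c b F] by linarith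
    moreover have "subset_mset.bdd_above (\<phi> ` S)"
      using up le by (intro subset_mset.bdd_aboveI[of _ b]) (auto intro: subset_mset.trans)
    then have "count b c = (SUP X\<in>\<phi> ` S. count X c)"
      using count_Sup_multiset_nonempty[of "\<phi> ` S" c] S eq by simp
    ultimately show False by linarith
  qed
  ultimately show ?thesis
    by (simp add: b_def subset_mset.less_le)
qed

section \<open>The Eliahou--Kervaire splitting\<close>

lemma add_mset_subset:
  assumes "v \<subseteq># t" "r \<notin># v" "r \<in># t"
  shows "add_mset r v \<subseteq># t"
proof (rule mset_subset_eqI)
  fix x
  show "count (add_mset r v) x \<le> count t x"
    using assms mset_subset_eq_count[OF assms(1), of x]
    by (cases "x = r") (auto simp: not_in_iff Suc_le_eq)
qed

text \<open>
  If the minimal generator first found below \<open>t\<close> does not involve \<open>x\<^sub>r\<close>, exchanging one of its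
  variables for \<open>x\<^sub>r\<close> leads to one that does, and \<open>t\<close> has room for the factor \<open>x\<^sub>r\<close>.
\<close>

lemma minimal_below_with_variable:
  assumes t: "t \<in> symbolic_multiples V F s" and r: "r \<in> V" "r \<in># t" and s: "s \<ge> 1" "size F \<le> s"
  obtains u where "u \<in> minimal_monomials (symbolic_multiples V F s)" "r \<in># u" "u \<subseteq># t"
proof -
  let ?U = "symbolic_multiples V F s"
  from t obtain v where v: "v \<in> minimal_monomials ?U" "v \<subseteq># t"
    by (rule minimal_monomial_below)
  show thesis
  proof (cases "r \<in># v")
    case True
    with v that show thesis by blast
  next
    case False
    have "v \<in> ?U" using v by (simp add: minimal_monomials_def)
    then have "v - F \<noteq> {#}"
      using r s by (intro symbolic_multiples_excess) auto
    then obtain c where "c \<in># v - F" by blast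
    with minimal_exchange[OF v(1) r(1) False _ s(1)] obtain u
      where u: "u \<in> minimal_monomials ?U" "u \<subseteq># add_mset r (v - {#c#})" "count u r = 1"
      by blast
    note u(2)
    also have "add_mset r (v - {#c#}) \<subseteq># add_mset r v" by simp
    also have "\<dots> \<subseteq># t" using v(2) False r(2) by (rule add_mset_subset)
    finally have "u \<subseteq># t" .
    moreover have "r \<in># u" using u(3) by (simp flip: count_greater_zero_iff)
    ultimately show thesis using u(1) that by blast
  qed
qed

text \<open>
  The monomial form of \<open>L\<^sub>1 = I \<inter> \<langle>x\<^sub>r\<rangle>\<close>.
\<close>

lemma multiples_with_variable:
  assumes "r \<in> V" "s \<ge> 1" "size F \<le> s"
  shows "multiples V {w \<in> minimal_monomials (symbolic_multiples V F s). r \<in># w} =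
    {t \<in> symbolic_multiples V F s. r \<in># t}"
proof (intro equalityI subsetI)
  have up: "monomial_upset V (symbolic_multiples V F s)"
    using assms(1) by (intro symbolic_multiples_upset) auto
  fix t assume "t \<in> multiples V {w \<in> minimal_monomials (symbolic_multiples V F s). r \<in># w}"
  then obtain w where w: "w \<in> symbolic_multiples V F s" "r \<in># w" "w \<subseteq># t" "set_mset t \<subseteq> V"
    by (auto simp: multiples_def minimal_monomials_def)
  with monomial_upsetD[OF up] show "t \<in> {t \<in> symbolic_multiples V F s. r \<in># t}"
    by (auto dest: mset_subset_eqD)
next
  fix t assume t: "t \<in> {t \<in> symbolic_multiples V F s. r \<in># t}"
  then obtain u where "u \<in> minimal_monomials (symbolic_multiples V F s)" "r \<in># u" "u \<subseteq># t"
    using minimal_below_with_variable[of t V F s r] assms by auto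
  moreover have "set_mset t \<subseteq> V"
    using t assms(1) mem_symbolic_multiples[of V t F s] by blast
  ultimately show "t \<in> multiples V {w \<in> minimal_monomials (symbolic_multiples V F s). r \<in># w}"
    by (auto simp: multiples_def)
qed

text \<open>
  For \<open>L\<^sub>1 = I \<inter> \<langle>x\<^sub>r\<rangle>\<close> the intersection \<open>L\<^sub>1 \<inter> L\<^sub>2\<close> is \<open>x\<^sub>r L\<^sub>2\<close>, as the generators of \<open>L\<^sub>2\<close> do not
  involve \<open>x\<^sub>r\<close>.
\<close>

lemma minimal_common_multiple:
  assumes r: "r \<in> V" and s: "s \<ge> 1" "size F \<le> s"
    and M: "M1 = {w \<in> minimal_monomials (symbolic_multiples V F s). r \<in># w}"
      "M2 = {w \<in> minimal_monomials (symbolic_multiples V F s). r \<notin># w}"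
    and w: "w \<in> minimal_monomials (multiples V M1 \<inter> multiples V M2)"
  obtains v where "v \<in> M2" "w = add_mset r v"
proof -
  let ?U = "symbolic_multiples V F s"
  have V: "V \<noteq> {}" using r by blast
  have U1: "multiples V M1 = {t \<in> ?U. r \<in># t}"
    unfolding M using r s by (rule multiples_with_variable)
  have w1: "w \<in> multiples V M1" "w \<in> multiples V M2"
    using w by (simp_all add: minimal_monomials_def)
  from w1(2) obtain v where v: "v \<in> M2" "v \<subseteq># w" and w_V: "set_mset w \<subseteq> V"
    by (auto simp: multiples_def)
  have "r \<notin># v" "v \<in> ?U" using v(1) by (auto simp: M minimal_monomials_def)
  have "r \<in># w" using w1(1) by (simp add: U1)
  with v(2) \<open>r \<notin># v\<close> have le: "add_mset r v \<subseteq># w"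
    by (rule add_mset_subset)
  have "set_mset (add_mset r v) \<subseteq> V"
    using set_mset_mono[OF le] w_V by blast
  moreover from this have "add_mset r v \<in> ?U"
    using monomial_upsetD[OF symbolic_multiples_upset[OF V] \<open>v \<in> ?U\<close>, of "add_mset r v"] by simp
  ultimately have "add_mset r v \<in> multiples V M1 \<inter> multiples V M2"
    unfolding U1 using v(1) by (auto simp: multiples_def intro!: bexI[of _ v])
  with w le have "w = add_mset r v"
    unfolding minimal_monomials_def by blast
  with v(1) show thesis by (rule that)
qed

text \<open>
  Unless \<open>L\<^sub>1 = 0\<close>, a minimal generator of \<open>L\<^sub>1 \<inter> L\<^sub>2\<close> is \<open>x\<^sub>r v\<close> for a generator \<open>v\<close> of \<open>L\<^sub>2\<close>. The second component of the
  splitting function returns \<open>v\<close>, and strictness is visible at \<open>x\<^sub>r\<close>. The first one returns a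
  generator of \<open>L\<^sub>1\<close> that divides \<open>x\<^sub>r v / x\<^sub>c\<close>, where \<open>x\<^sub>c\<close> is the least variable of \<open>v / F\<close>. It
  contains \<open>x\<^sub>r\<close> exactly once, so its least common multiple with \<open>v\<close> is \<open>x\<^sub>r v\<close>.
\<close>

lemma EK_splitting_symbolic_multiples:
  fixes V :: "'v :: linorder set"
  assumes fin: "finite V" and r: "r \<in> V" and s: "s \<ge> 1"
    and F: "set_mset F \<subseteq> V" "r \<notin># F" "\<And>x. count F x \<le> 1"
    and M: "M1 = {w \<in> minimal_monomials (symbolic_multiples V F s). r \<in># w}"
      "M2 = {w \<in> minimal_monomials (symbolic_multiples V F s). r \<notin># w}"
  shows "EK_splitting (poly_ring V :: ('v, 'k :: field) mpoly ring)
    (monomial_span (symbolic_multiples V F s)) (monomial_span (multiples V M1)) (monomial_span (multiples V M2))"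
proof -
  let ?R = "poly_ring V :: ('v, 'k) mpoly ring"
  let ?span = "monomial_span :: 'v multiset set \<Rightarrow> ('v, 'k) mpoly set"
  let ?U = "symbolic_multiples V F s" and ?U1 = "multiples V M1" and ?U2 = "multiples V M2"
  have V: "V \<noteq> {}" using r by blast
  note mem = mem_symbolic_multiples[OF V]
  have up: "monomial_upset V ?U" using V by (rule symbolic_multiples_upset)
  have up1: "monomial_upset V ?U1" and up2: "monomial_upset V ?U2"
    by (rule multiples_upset)+
  have up12: "monomial_upset V (?U1 \<inter> ?U2)"
    unfolding monomial_upset_def
  proof (intro conjI ballI allI impI)
    fix t u assume "t \<in> ?U1 \<inter> ?U2" "t \<subseteq># u" "set_mset u \<subseteq> V"
    then show "u \<in> ?U1 \<inter> ?U2"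
      using monomial_upsetD[OF up1] monomial_upsetD[OF up2] by blast
  qed (simp add: multiples_def)
  have min_V: "set_mset a \<subseteq> V" if "a \<in> minimal_monomials ?U" for a
    using that by (simp add: minimal_monomials_def mem)
  have M_Un: "minimal_monomials ?U = M1 \<union> M2" and M_Int: "M1 \<inter> M2 = {}"
    unfolding M by auto
  have gens: "min_gens ?R (?span ?U) = minimal_monomials ?U"
    "min_gens ?R (?span ?U1) = M1" "min_gens ?R (?span ?U2) = M2"
    "min_gens ?R (?span ?U1 \<inter> ?span ?U2) = minimal_monomials (?U1 \<inter> ?U2)"
  proof -
    show "min_gens ?R (?span ?U) = minimal_monomials ?U"
      using up by (rule min_gens_monomial_span)
    show "min_gens ?R (?span ?U1 \<inter> ?span ?U2) = minimal_monomials (?U1 \<inter> ?U2)"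
      unfolding monomial_span_Int using up12 by (rule min_gens_monomial_span)
    show "min_gens ?R (?span ?U1) = M1"
      unfolding min_gens_monomial_span[OF up1]
      by (rule minimal_monomials_multiples[of _ ?U]) (use min_V M_Un in auto)
    show "min_gens ?R (?span ?U2) = M2"
      unfolding min_gens_monomial_span[OF up2]
      by (rule minimal_monomials_multiples[of _ ?U]) (use min_V M_Un in auto)
  qed
  have "multiples V (M1 \<union> M2) = ?U"
    using multiples_minimal_monomials[OF up] by (simp add: M_Un)
  then have sum: "?span ?U = ?span ?U1 <+>\<^bsub>?R\<^esub> ?span ?U2"
    unfolding monomial_span_sum monomial_span_eq_iff by (auto simp: multiples_def)
  define W where "W = minimal_monomials (?U1 \<inter> ?U2)"
  have "\<exists>\<phi> \<psi>. \<phi> \<in> W \<rightarrow> M1 \<and> \<psi> \<in> W \<rightarrow> M2 \<and> (\<forall>w \<in> W. w = \<phi> w \<union># \<psi> w) \<and>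
      (\<forall>S. S \<noteq> {} \<and> S \<subseteq> W \<longrightarrow> Sup (\<phi> ` S) \<subset># Sup S \<and> Sup (\<psi> ` S) \<subset># Sup S)"
  proof (cases "size F \<le> s")
    case False
    \<comment> \<open>Here \<open>F\<close> itself is a monomial of the ideal, so it is the only minimal generator; as it does
      not involve \<open>x\<^sub>r\<close>, the ideal \<open>L\<^sub>1\<close> is zero and the splitting function has empty domain.\<close>
    have "F \<in> ?U"
    proof -
      have "s + count F i \<le> size F" for i
        using F(3)[of i] False by linarith
      with F(1) show ?thesis by (simp add: mem)
    qed
    have "r \<notin># w" if "w \<in> minimal_monomials ?U" for w
    proof -
      have "F \<subseteq># w" using that by (simp add: minimal_monomials_def mem)
      with that \<open>F \<in> ?U\<close> have "F = w" by (auto simp: minimal_monomials_def)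
      with F(2) show ?thesis by simp
    qed
    then have "M1 = {}" unfolding M by blast
    then have "W = {}" by (simp add: W_def minimal_monomials_def multiples_def)
    then show ?thesis by simp
  next
    case True
    have W: "w - {#r#} \<in> M2 \<and> w = add_mset r (w - {#r#})" if "w \<in> W" for w
    proof -
      from minimal_common_multiple[OF r s True M that[unfolded W_def]]
      obtain v where "v \<in> M2" "w = add_mset r v" .
      then show ?thesis by simp
    qed
    \<comment> \<open>Adding \<open>x\<^sub>r\<close> to \<open>F\<close> keeps it from being the variable that is lowered:
      \<open>x\<^sub>r v\<close> and \<open>x\<^sub>r F\<close> have the same quotient as \<open>v\<close> and \<open>F\<close>.\<close>
    have excess: "w - add_mset r F \<noteq> {#}" if "w \<in> W" for w
    proof -
      from W[OF that] obtain v where v: "v \<in> M2" "w = add_mset r v" by blast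
      then have "v \<in> ?U" by (simp add: M minimal_monomials_def)
      from symbolic_multiples_excess[OF this V s True] v show ?thesis by simp
    qed
    have "\<exists>u \<in> M1. u \<subseteq># w \<and> count u r = 1 \<and>
        count u (Min (set_mset (w - add_mset r F))) < count w (Min (set_mset (w - add_mset r F)))"
      if "w \<in> W" for w
    proof -
      from W[OF that] obtain v where v: "v \<in> M2" "w = add_mset r v" by blast
      define c where "c = Min (set_mset (w - add_mset r F))"
      have "c \<in># w - add_mset r F"
        unfolding c_def using excess[OF that] by (intro Min_in) auto
      then have c: "c \<in># v - F" by (simp add: v)
      then have "c \<in># v" by (rule in_diffD)
      have v': "v \<in> minimal_monomials ?U" "r \<notin># v" using v(1) by (auto simp: M)
      then have "c \<noteq> r" using \<open>c \<in># v\<close> by blast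
      from minimal_exchange[OF v'(1) r v'(2) c s] obtain u
        where u: "u \<in> minimal_monomials ?U" "u \<subseteq># add_mset r (v - {#c#})" "count u r = 1" .
      have "r \<in># u" using u(3) by (simp flip: count_greater_zero_iff)
      then have "u \<in> M1" using u(1) by (simp add: M)
      moreover have "u \<subseteq># w"
        using u(2) subset_mset.trans[OF u(2), of w] by (simp add: v)
      moreover have "count u c < count w c"
        using mset_subset_eq_count[OF u(2), of c] \<open>c \<in># v\<close> \<open>c \<noteq> r\<close>
        by (simp add: v flip: count_greater_zero_iff)
      ultimately show ?thesis using u(3) unfolding c_def by blast
    qed
    then obtain \<phi> where \<phi>: "\<And>w. w \<in> W \<Longrightarrow> \<phi> w \<in> M1" "\<And>w. w \<in> W \<Longrightarrow> \<phi> w \<subseteq># w"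
        "\<And>w. w \<in> W \<Longrightarrow> count (\<phi> w) r = 1"
        "\<And>w. w \<in> W \<Longrightarrow> count (\<phi> w) (Min (set_mset (w - add_mset r F))) <
            count w (Min (set_mset (w - add_mset r F)))"
      by metis
    define \<psi> where "\<psi> w = w - {#r#}" for w
    have \<psi>_r: "r \<notin># \<psi> w" if "w \<in> W" for w
      using W[OF that] unfolding \<psi>_def M by blast
    have "w = \<phi> w \<union># \<psi> w" if "w \<in> W" for w
    proof (rule multiset_eqI)
      fix x
      show "count w x = count (\<phi> w \<union># \<psi> w) x"
      proof (cases "x = r")
        case True
        have "count w r = Suc (count (\<psi> w) r)"
          using W[OF that] unfolding \<psi>_def by (metis count_add_mset)
        with \<psi>_r[OF that] \<phi>(3)[OF that] True show ?thesis by (simp add: not_in_iff)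
      next
        case False
        then have "count (\<psi> w) x = count w x" by (simp add: \<psi>_def)
        with mset_subset_eq_count[OF \<phi>(2)[OF that], of x] show ?thesis by simp
      qed
    qed
    moreover have "Sup (\<phi> ` S) \<subset># Sup S \<and> Sup (\<psi> ` S) \<subset># Sup S" if S: "S \<noteq> {}" "S \<subseteq> W" for S
    proof
      have bound: "w \<subseteq># add_mset r (repeat_mset s (mset_set V))" if "w \<in> W" for w
      proof -
        from W[OF that] obtain v where v: "v \<in> minimal_monomials ?U" "w = add_mset r v"
          unfolding M by blast
        have "v \<subseteq># repeat_mset s (mset_set V)"
        proof (rule mset_subset_eqI)
          fix x
          show "count v x \<le> count (repeat_mset s (mset_set V)) x"
          proof (cases "x \<in> V")
            case True
            then show ?thesis
              using minimal_symbolic_count_le[OF v(1) V s F(3), of x] fin by simp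
          next
            case False
            then have "x \<notin># v" using min_V[OF v(1)] by blast
            then show ?thesis by (simp add: not_in_iff)
          qed
        qed
        then show ?thesis by (simp add: v)
      qed
      then have bdd: "subset_mset.bdd_above S"
        using S(2) by (intro subset_mset.bdd_aboveI) blast
      show "Sup (\<phi> ` S) \<subset># Sup S"
      proof (rule Sup_lowered_strict[OF S(1) bdd, of \<phi> "add_mset r F"])
        fix w assume "w \<in> S"
        with S(2) have w: "w \<in> W" by blast
        show "\<phi> w \<subseteq># w" using w by (rule \<phi>(2))
        show "w - add_mset r F \<noteq> {#}" using w by (rule excess)
        show "count (\<phi> w) c < count w c" if "c = Min (set_mset (w - add_mset r F))" for c
          using \<phi>(4)[OF w] that by simp
      qed
      have \<psi>_le: "\<psi> w \<subseteq># Sup S" if "w \<in> S" for w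
        using subset_mset.cSup_upper[OF that bdd] diff_subset_eq_self[of w "{#r#}"]
        unfolding \<psi>_def by (rule subset_mset.trans[rotated])
      have "Sup (\<psi> ` S) \<subseteq># Sup S"
        using S(1) \<psi>_le by (intro subset_mset.cSup_least) auto
      moreover have "Sup (\<psi> ` S) \<noteq> Sup S"
      proof -
        have bdd': "subset_mset.bdd_above (\<psi> ` S)"
          using \<psi>_le by (intro subset_mset.bdd_aboveI[of _ "Sup S"]) auto
        have "r \<notin># Sup (\<psi> ` S)"
          using \<psi>_r S(2) by (auto simp: in_Sup_multiset_iff[OF bdd'])
        moreover have "r \<in># Sup S"
        proof -
          obtain w where "w \<in> S" using S(1) by blast
          moreover from this have "r \<in># w"
            using W S(2) by (metis subsetD union_single_eq_member)
          ultimately show ?thesis by (auto simp: in_Sup_multiset_iff[OF bdd])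
        qed
        ultimately show ?thesis by auto
      qed
      ultimately show "Sup (\<psi> ` S) \<subset># Sup S"
        by (simp add: subset_mset.less_le)
    qed
    moreover have "\<phi> \<in> W \<rightarrow> M1" "\<psi> \<in> W \<rightarrow> M2"
      using \<phi>(1) W by (auto simp: \<psi>_def)
    ultimately show ?thesis by blast
  qed
  then show ?thesis
    unfolding EK_splitting_def gens
    using monomial_ideal_monomial_span[OF up] monomial_ideal_monomial_span[OF up1]
      monomial_ideal_monomial_span[OF up2] sum M_Un M_Int
    unfolding W_def by blast
qed

theorem theorem3p5:
  fixes m s r :: nat
    and R :: "(nat, 'k :: field) mpoly ring"
    and G H :: "nat graph"
    and I L1 L2 :: "(nat, 'k) mpoly set"
  assumes "m \<ge> 3" and "s \<ge> 2"
    and "r \<in> {1..m}" and "int r \<noteq> int m - int s - 1"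
    and "R = poly_ring {1..m}"
    and "G = complete_graph {1..m}"
    and "H = induced_subgraph G {1..r}"
    and "I = diff_symbolic_power R G H s"
    and "L1 = Idl\<^bsub>R\<^esub> (monomial ` {w \<in> min_gens R I. r \<in># w})"
    and "L2 = Idl\<^bsub>R\<^esub> (monomial ` {w \<in> min_gens R I. r \<notin># w})"
  shows "EK_splitting R I L1 L2 \<and> (m \<le> r + s \<longrightarrow> L1 = I \<inter> Idl\<^bsub>R\<^esub> {indet r})"
proof -
  define V where "V = {1..m}"
  define F where "F = mset_set (V - {1..r})"
  define U where "U = symbolic_multiples V F s"
  define M1 where "M1 = {w \<in> minimal_monomials U. r \<in># w}"
  define M2 where "M2 = {w \<in> minimal_monomials U. r \<notin># w}"
  have V: "finite V" "V \<noteq> {}" "r \<in> V" and W: "{1..r} \<subseteq> V"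
    using assms(3) by (auto simp: V_def)
  have R: "R = poly_ring V" by (simp add: V_def assms(5))
  have up: "monomial_upset V U"
    unfolding U_def using V(2) by (rule symbolic_multiples_upset)
  have I: "I = monomial_span U"
    using diff_symbolic_power_complete_graph[OF V(1,2) W, of s, where 'k = 'k]
    by (simp add: assms(6-8) R U_def F_def V_def)
  have gens: "min_gens R I = minimal_monomials U"
    unfolding R I using up by (rule min_gens_monomial_span)
  have min_V: "set_mset w \<subseteq> V" if "w \<in> minimal_monomials U" for w
    using that V(2) by (simp add: minimal_monomials_def U_def mem_symbolic_multiples)
  have L1: "L1 = monomial_span (multiples V M1)"
    unfolding assms(9) gens unfolding R M1_def by (rule Idl_monomials) (use min_V in auto)
  have L2: "L2 = monomial_span (multiples V M2)"
    unfolding assms(10) gens unfolding R M2_def by (rule Idl_monomials) (use min_V in auto)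
  have s: "s \<ge> 1" using assms(2) by simp
  have F: "set_mset F \<subseteq> V" "r \<notin># F" "\<And>x. count F x \<le> 1"
    using assms(3) V(1) by (auto simp: F_def count_mset_set')
  have "EK_splitting R I L1 L2"
    unfolding R I L1 L2 unfolding U_def
    by (rule EK_splitting_symbolic_multiples[OF V(1,3) s F])
      (simp_all add: M1_def M2_def U_def)
  moreover have "L1 = I \<inter> Idl\<^bsub>R\<^esub> {indet r}" if "m \<le> r + s"
  proof -
    have "V - {1..r} = {r<..m}"
      using assms(3) by (auto simp: V_def)
    then have "size F \<le> s"
      using that by (simp add: F_def)
    from multiples_with_variable[OF V(3) s this]
    have "multiples V M1 = {t \<in> U. r \<in># t}"
      by (simp add: M1_def U_def)
    also have "\<dots> = U \<inter> multiples V {{#r#}}"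
      using mem_symbolic_multiples[OF V(2)] by (auto simp: multiples_def U_def)
    finally have "L1 = I \<inter> monomial_span (multiples V {{#r#}})"
      by (simp add: L1 I monomial_span_Int)
    moreover have "Idl\<^bsub>R\<^esub> (monomial ` {{#r#}}) = (monomial_span (multiples V {{#r#}}) :: (nat, 'k) mpoly set)"
      unfolding R using V(3) by (intro Idl_monomials) auto
    ultimately show ?thesis by (simp add: indet_def)
  qed
  ultimately show ?thesis by blast
qed

end
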